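(* (Doubling) Let $(X,d_X,m_X)$ be a metric measure space with $\operatorname{supp}m_X=X$ satisfying $CD(k,N)$ for an admissible $k:X\to\mathbb R$ and $N\ge1$. Then the doubling property holds on each bounded set $X'\subset X$. If $k\ge0$ on $X'$, the doubling constant is $\le2^N$; otherwise it can be estimated in terms of $\underline k=\inf_{X'}k$, $N$ and the diameter $L$ of $X'$ by $$C\le2^N\,\mathfrak c_{\underline k/(N-1)}(L)^{N-1},$$ where the factor $\mathfrak c_{\underline k/(N-1)}(L)^{N-1}$ is read as $1$ if $N=1$.
   Context: The doubling property on a bounded set $X'$ with constant $C$ means $m_X(B_{2r}(x))\le C\,m_X(B_r(x))$ for all $x\in X'$ and $r>0$ with $B_{2r}(x)\subset X'$. For $K\in\mathbb R$, $\mathfrak c_K=\mathfrak s_K'$, where $\mathfrak s_K$ solves $u''+Ku=0$, $u(0)=0$, $u'(0)=1$ (so $\mathfrak c_K(L)=\cosh(\sqrt{-K}L)$ for $K<0$). A function $k:X\to\mathbb R$ is admissible if it is lower semicontinuous and locally bounded from below. A metric measure space $(X,d_X,m_X)$ is a complete separable metric space $(X,d_X)$ with a Borel measure $m_X$ such that for every $x\in X$ there is $r>0$ with $m_X(B_r(x))\in(0,\infty)$; also $m_X(X)\ne 0$. A geodesic is a distance-minimizing curve $\gamma:[0,1]\to X$ of constant speed; $|\dot\gamma|$ denotes its speed, i.e. its length. $\mathcal G(X)$ is the set of geodesics with the sup-distance, and $e_t(\gamma)=\gamma(t)$. $\mathcal P_2(X)$ is the set of Borel probability measures with finite second moment, with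 the $L^2$-Wasserstein distance, and $\mathcal P_2(X,m_X)$ is the subset of $m_X$-absolutely continuous ones. A dynamical optimal coupling of $\mu_0,\mu_1$ is a probability measure $\Pi$ on $\mathcal G(X)$ such that $(e_0,e_1)_*\Pi$ is an optimal coupling (for the cost $d_X^2$) of $\mu_0,\mu_1$. Distortion coefficients. For $\theta>0$ and continuous $\kappa:[0,\theta]\to\mathbb R$ let $\mathfrak s_\kappa$ be the solution of $u''+\kappa u=0$, $u(0)=0$, $u'(0)=1$. For $t\in[0,1]$ put $\sigma^{(t)}_\kappa(\theta)=\mathfrak s_\kappa(t\theta)/\mathfrak s_\kappa(\theta)$ if $\mathfrak s_\kappa>0$ on $(0,\theta]$, and $\sigma^{(t)}_\kappa(\theta)=\infty$ otherwise. For lower semicontinuous $\kappa:[0,\theta]\to\mathbb R$ put $\kappa_n(s)=\inf_{r\in[0,\theta]}\{\kappa(r)+n|s-r|\}$ and $\sigma^{(t)}_\kappa(\theta)=\lim_{n\to\infty}\sigma^{(t)}_{\kappa_n}(\theta)\in[0,\infty]$ (consistent for continuous $\kappa$). Put $\sigma_\kappa^{(t)}(0)=t$. For lower semicontinuous $k:X\to\mathbb R$ and a geodesic $\gamma$ with $\theta=|\dot\gamma|$ let $\bar\gamma:[0,\theta]\to X$ be its unit speed reparametrization, $k^+_\gamma=k_\gamma=k\circ\bar\gamma$ and $k^-_\gamma(s)=k_\gamma(\theta-s)$. For $N>0$ set $\sigma^{(t)}_{k^\pm_\gamma,N}(\theta)=\sigma^{(t)}_{k^\pm_\gamma/N}(\theta)$.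 For $N>1$ set $\tau^{(t)}_{k^\pm_\gamma,N}(\theta)=t^{1/N}\big[\sigma^{(t)}_{k^\pm_\gamma,N-1}(\theta)\big]^{(N-1)/N}$; for $N=1$ set $\tau^{(t)}_{k_\gamma^\pm,1}(\theta)=\theta\cdot\infty$ if $k_\gamma>0$ and $=t$ otherwise. Conventions: $r\cdot\infty=\infty$ for $r>0$, $0\cdot\infty=0$, $\infty^\alpha=\infty$ for $\alpha>0$. Condition $CD(k,N)$, $N\ge1$. For $\nu=\varrho m_X+\nu^s$ (Lebesgue decomposition) let $S_N(\nu)=-\int_X\varrho^{1-1/N}\,dm_X$. $(X,d_X,m_X)$ satisfies $CD(k,N)$ if for each pair $\nu_0=\varrho_0m_X,\nu_1=\varrho_1m_X\in\mathcal P_2(X,m_X)$ with bounded support there exist a dynamical optimal coupling $\Pi$ of $\nu_0,\nu_1$ and a geodesic $(\nu_t)_{t\in[0,1]}\subset\mathcal P_2(X,m_X)$ from $\nu_0$ to $\nu_1$ such that $$S_{N'}(\nu_t)\le-\int\Big[\tau^{(1-t)}_{k^-_\gamma,N'}(|\dot\gamma|)\varrho_0(\gamma(0))^{-1/N'}+\tau^{(t)}_{k^+_\gamma,N'}(|\dot\gamma|)\varrho_1(\gamma(1))^{-1/N'}\Big]d\Pi(\gamma)$$ for all $t\in[0,1]$ and all $N'\ge N$. *)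

theory Defs
  imports "HOL-Analysis.Analysis" "HOL-Probability.Probability"
begin

text \<open>The complete separable metric space is the type \<^typ>\<open>'a::polish_space\<close> with its \<^const>\<open>dist\<close>.\<close>

definition metric_measure_space :: "'a::polish_space measure \<Rightarrow> bool" where
  "metric_measure_space M \<longleftrightarrow>
     sets M = sets borel \<and>
     (\<forall>x. \<exists>r>0. 0 < emeasure M (ball x r) \<and> emeasure M (ball x r) < \<infinity>) \<and>
     emeasure M UNIV \<noteq> 0"

definition measure_support :: "'a::metric_space measure \<Rightarrow> 'a set" where
  "measure_support M = {x. \<forall>r>0. emeasure M (ball x r) > 0}"

definition admissible :: "('a::metric_space \<Rightarrow> real) \<Rightarrow> bool" where
  "admissible k \<longleftrightarrow>
     (\<forall>a. open {x. a < k x}) \<and> (\<forall>x. \<exists>r>0. bdd_below (k ` ball x r))"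

definition doubling_on :: "'a::metric_space measure \<Rightarrow> 'a set \<Rightarrow> real \<Rightarrow> bool" where
  "doubling_on M X' C \<longleftrightarrow>
     (\<forall>x\<in>X'. \<forall>r>0. ball x (2 * r) \<subseteq> X' \<longrightarrow>
        emeasure M (ball x (2 * r)) \<le> ennreal C * emeasure M (ball x r))"

definition geodesic_wrt :: "('b \<Rightarrow> 'b \<Rightarrow> real) \<Rightarrow> (real \<Rightarrow> 'b) \<Rightarrow> bool" where
  "geodesic_wrt d c \<longleftrightarrow>
     (\<forall>s\<in>{0..1}. \<forall>t\<in>{0..1}. d (c s) (c t) = \<bar>s - t\<bar> * d (c 0) (c 1))"

text \<open>
  A geodesic on \<open>[0,1]\<close> is represented by its constant continuation to a bounded continuous function
  on the real line; \<^const>\<open>dist\<close> on bounded continuous functions is then the sup-distance over \<open>[0,1]\<close>.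
\<close>

definition geodesics :: "(real \<Rightarrow>\<^sub>C 'a::metric_space) set" where
  "geodesics = {\<gamma>. geodesic_wrt dist (apply_bcontfun \<gamma>) \<and>
     (\<forall>t\<le>0. apply_bcontfun \<gamma> t = apply_bcontfun \<gamma> 0) \<and>
     (\<forall>t\<ge>1. apply_bcontfun \<gamma> t = apply_bcontfun \<gamma> 1)}"

definition speed :: "(real \<Rightarrow>\<^sub>C 'a::metric_space) \<Rightarrow> real" where
  "speed \<gamma> = dist (apply_bcontfun \<gamma> 0) (apply_bcontfun \<gamma> 1)"

definition unit_speed :: "(real \<Rightarrow>\<^sub>C 'a::metric_space) \<Rightarrow> real \<Rightarrow> 'a" where
  "unit_speed \<gamma> s = apply_bcontfun \<gamma> (s / speed \<gamma>)"

definition k_plus :: "('a::metric_space \<Rightarrow> real) \<Rightarrow> (real \<Rightarrow>\<^sub>C 'a) \<Rightarrow> real \<Rightarrow> real" where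
  "k_plus k \<gamma> s = k (unit_speed \<gamma> s)"

definition k_minus :: "('a::metric_space \<Rightarrow> real) \<Rightarrow> (real \<Rightarrow>\<^sub>C 'a) \<Rightarrow> real \<Rightarrow> real" where
  "k_minus k \<gamma> s = k_plus k \<gamma> (speed \<gamma> - s)"

definition P2 :: "'a::polish_space measure set" where
  "P2 = {\<mu>. prob_space \<mu> \<and> sets \<mu> = sets borel \<and>
     (\<exists>x0. (\<integral>\<^sup>+ x. ennreal ((dist x0 x)\<^sup>2) \<partial>\<mu>) < \<infinity>)}"

definition P2_ac :: "'a::polish_space measure \<Rightarrow> 'a measure set" where
  "P2_ac M = {\<mu> \<in> P2. absolutely_continuous M \<mu>}"

definition couplings ::
    "'a::polish_space measure \<Rightarrow> 'a measure \<Rightarrow> ('a \<times> 'a) measure set" where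
  "couplings \<mu> \<nu> = {\<pi>. prob_space \<pi> \<and> sets \<pi> = sets borel \<and>
     distr \<pi> borel fst = \<mu> \<and> distr \<pi> borel snd = \<nu>}"

definition transport_cost :: "('a::polish_space \<times> 'a) measure \<Rightarrow> ennreal" where
  "transport_cost \<pi> = (\<integral>\<^sup>+ p. ennreal ((dist (fst p) (snd p))\<^sup>2) \<partial>\<pi>)"

definition optimal_coupling ::
    "'a::polish_space measure \<Rightarrow> 'a measure \<Rightarrow> ('a \<times> 'a) measure \<Rightarrow> bool" where
  "optimal_coupling \<mu> \<nu> \<pi> \<longleftrightarrow>
     \<pi> \<in> couplings \<mu> \<nu> \<and> (\<forall>\<pi>'\<in>couplings \<mu> \<nu>. transport_cost \<pi> \<le> transport_cost \<pi>')"

text \<open>Real-valued because the infimum is finite for measures in \<^const>\<open>P2\<close>.\<close>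

definition W2 :: "'a::polish_space measure \<Rightarrow> 'a measure \<Rightarrow> real" where
  "W2 \<mu> \<nu> = sqrt (enn2real (INF \<pi>\<in>couplings \<mu> \<nu>. transport_cost \<pi>))"

definition dynamical_optimal_coupling ::
    "'a::polish_space measure \<Rightarrow> 'a measure \<Rightarrow> (real \<Rightarrow>\<^sub>C 'a) measure \<Rightarrow> bool" where
  "dynamical_optimal_coupling \<mu> \<nu> \<Xi> \<longleftrightarrow>
     prob_space \<Xi> \<and> sets \<Xi> = sets (restrict_space borel geodesics) \<and>
     optimal_coupling \<mu> \<nu>
       (distr \<Xi> borel (\<lambda>\<gamma>. (apply_bcontfun \<gamma> 0, apply_bcontfun \<gamma> 1)))"

text \<open>\<open>u'' + \<kappa> u = 0\<close>, \<open>u 0 = 0\<close>, \<open>u' 0 = 1\<close> on the interval \<open>I\<close>, with one-sided derivatives at its endpoints.\<close>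

definition sn_solution :: "real set \<Rightarrow> (real \<Rightarrow> real) \<Rightarrow> (real \<Rightarrow> real) \<Rightarrow> bool" where
  "sn_solution I \<kappa> u \<longleftrightarrow> (\<exists>u'. u 0 = 0 \<and> u' 0 = 1 \<and>
     (\<forall>s\<in>I. (u has_real_derivative u' s) (at s within I) \<and>
            (u' has_real_derivative - (\<kappa> s * u s)) (at s within I)))"

text \<open>Only the values on \<open>I\<close> are determined.\<close>

definition sn :: "real set \<Rightarrow> (real \<Rightarrow> real) \<Rightarrow> real \<Rightarrow> real" where
  "sn I \<kappa> = (SOME u. sn_solution I \<kappa> u)"

definition cn :: "real \<Rightarrow> real \<Rightarrow> real" where
  "cn K = deriv (sn UNIV (\<lambda>_. K))"

definition sigma_cont :: "real \<Rightarrow> (real \<Rightarrow> real) \<Rightarrow> real \<Rightarrow> ennreal" where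
  "sigma_cont t \<kappa> \<theta> =
     (if \<forall>s\<in>{0<..\<theta>}. sn {0..\<theta>} \<kappa> s > 0
      then ennreal (sn {0..\<theta>} \<kappa> (t * \<theta>) / sn {0..\<theta>} \<kappa> \<theta>) else \<infinity>)"

definition lipschitz_approx :: "(real \<Rightarrow> real) \<Rightarrow> real \<Rightarrow> nat \<Rightarrow> real \<Rightarrow> real" where
  "lipschitz_approx \<kappa> \<theta> n s = (INF r\<in>{0..\<theta>}. \<kappa> r + real n * \<bar>s - r\<bar>)"

definition sigma :: "real \<Rightarrow> (real \<Rightarrow> real) \<Rightarrow> real \<Rightarrow> ennreal" where
  "sigma t \<kappa> \<theta> =
     (if \<theta> = 0 then ennreal t
      else lim (\<lambda>n. sigma_cont t (lipschitz_approx \<kappa> \<theta> n) \<theta>))"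

definition ennreal_powr :: "ennreal \<Rightarrow> real \<Rightarrow> ennreal" where
  "ennreal_powr x a = (if x = \<infinity> then \<infinity> else ennreal (enn2real x powr a))"

text \<open>In \<^typ>\<open>ennreal\<close>, \<open>0 * \<infinity> = 0\<close>, as required here.\<close>

definition tau :: "real \<Rightarrow> real \<Rightarrow> (real \<Rightarrow> real) \<Rightarrow> real \<Rightarrow> ennreal" where
  "tau N t \<kappa> \<theta> =
     (if N = 1 then (if \<forall>s\<in>{0..\<theta>}. \<kappa> s > 0 then ennreal \<theta> * \<infinity> else ennreal t)
      else ennreal (t powr (1 / N)) *
           ennreal_powr (sigma t (\<lambda>s. \<kappa> s / (N - 1)) \<theta>) ((N - 1) / N))"

definition lebesgue_decomposition ::
    "'a measure \<Rightarrow> 'a measure \<Rightarrow> ('a \<Rightarrow> real) \<Rightarrow> 'a measure \<Rightarrow> bool" where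
  "lebesgue_decomposition M \<nu> \<rho> \<nu>s \<longleftrightarrow>
     \<rho> \<in> borel_measurable M \<and> (\<forall>x. 0 \<le> \<rho> x) \<and> sets \<nu>s = sets M \<and>
     (\<exists>A\<in>sets M. emeasure M A = 0 \<and> emeasure \<nu>s (space M - A) = 0) \<and>
     (\<forall>A\<in>sets M. emeasure \<nu> A = (\<integral>\<^sup>+ x\<in>A. ennreal (\<rho> x) \<partial>M) + emeasure \<nu>s A)"

definition ac_density :: "'a measure \<Rightarrow> 'a measure \<Rightarrow> 'a \<Rightarrow> real" where
  "ac_density M \<nu> = (SOME \<rho>. \<exists>\<nu>s. lebesgue_decomposition M \<nu> \<rho> \<nu>s)"

text \<open>Since \<open>0 powr 0 = 0\<close>, the case \<open>N = 1\<close> gives minus the \<open>M\<close>-measure of the set where the density is positive.\<close>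

definition S_entropy :: "real \<Rightarrow> 'a measure \<Rightarrow> 'a measure \<Rightarrow> ereal" where
  "S_entropy N M \<nu> =
     - enn2ereal (\<integral>\<^sup>+ x. ennreal (ac_density M \<nu> x powr (1 - 1 / N)) \<partial>M)"

text \<open>
  The value \<open>0 powr (- 1 / N') = 0\<close> plays no role: the marginals of \<open>\<Xi>\<close> have the densities \<open>\<rho>0\<close> and
  \<open>\<rho>1\<close>, which are therefore positive at the endpoints of \<open>\<Xi>\<close>-almost every geodesic.
\<close>

definition CD :: "'a::polish_space measure \<Rightarrow> ('a \<Rightarrow> real) \<Rightarrow> real \<Rightarrow> bool" where
  "CD M k N \<longleftrightarrow>
     (\<forall>\<rho>0 \<rho>1 :: 'a \<Rightarrow> real.
        \<rho>0 \<in> borel_measurable M \<longrightarrow> (\<forall>x. 0 \<le> \<rho>0 x) \<longrightarrow>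
        \<rho>1 \<in> borel_measurable M \<longrightarrow> (\<forall>x. 0 \<le> \<rho>1 x) \<longrightarrow>
        density M (\<lambda>x. ennreal (\<rho>0 x)) \<in> P2_ac M \<longrightarrow>
        bounded (measure_support (density M (\<lambda>x. ennreal (\<rho>0 x)))) \<longrightarrow>
        density M (\<lambda>x. ennreal (\<rho>1 x)) \<in> P2_ac M \<longrightarrow>
        bounded (measure_support (density M (\<lambda>x. ennreal (\<rho>1 x)))) \<longrightarrow>
        (\<exists>\<Xi> \<nu>. dynamical_optimal_coupling (density M (\<lambda>x. ennreal (\<rho>0 x)))
             (density M (\<lambda>x. ennreal (\<rho>1 x))) \<Xi> \<and>
           (\<forall>t\<in>{0..1}. \<nu> t \<in> P2_ac M) \<and> geodesic_wrt W2 \<nu> \<and>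
           \<nu> 0 = density M (\<lambda>x. ennreal (\<rho>0 x)) \<and> \<nu> 1 = density M (\<lambda>x. ennreal (\<rho>1 x)) \<and>
           (\<forall>t\<in>{0..1}. \<forall>N'\<ge>N.
              S_entropy N' M (\<nu> t) \<le>
              - enn2ereal (\<integral>\<^sup>+ \<gamma>.
                  tau N' (1 - t) (k_minus k \<gamma>) (speed \<gamma>) *
                    ennreal (\<rho>0 (apply_bcontfun \<gamma> 0) powr (- 1 / N')) +
                  tau N' t (k_plus k \<gamma>) (speed \<gamma>) *
                    ennreal (\<rho>1 (apply_bcontfun \<gamma> 1) powr (- 1 / N')) \<partial>\<Xi>))))"

end

theory Submission
  imports Defs
begin

text \<open>
The idea is the classical volume comparison by transport. Mass spread uniformly over a tiny ball around \<open>x\<close> and over a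
set \<open>B\<close> in the ball of radius \<open>2 r\<close> is interpolated; the midpoint measure lives in the ball of
radius \<open>r\<close>. By Jensen its entropy integral is at most the \<open>N\<close>-th root of the measure of that ball. By the
curvature-dimension inequality at time \<open>1/2\<close> it is at least the sum of the \<open>N\<close>-th roots of the measures of both sets,
times a lower bound for the distortion coefficients, which is \<open>1/2\<close> in nonnegative curvature. Taking \<open>N\<close>-th powers 
gives the constant \<open>2 powr N\<close>, and in negative curvature the hyperbolic factor (\<open>midpoint_brunn_minkowski\<close>, \<open>doubling_smaller_balls\<close>).

Three points need work. The distortion coefficients belong to variable curvature along the geodesic and are limits over
Lipschitz approximations; Sturm comparison makes these limits exist and bounds them below by the coefficient of a constant
curvature (\<open>sturm_quotient_mono\<close>, \<open>tau_half_lower\<close>). The midpoint measure is only known to be a midpoint for the Wasserstein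
distance, so its carrier has to be located by gluing nearly optimal couplings
(\<open>W2_midpoint_concentration\<close>). Finally, the function \<open>k\<close> is bounded below only locally; a lower bound on a bounded set comes
from compactness, which itself rests on volume comparison: small balls satisfy doubling, hence are totally bounded, and
a complete locally compact length space is proper (\<open>locally_compact_length_space_proper\<close>, \<open>CD_bounded_below\<close>).
\<close>

section \<open>The equation \<open>u'' + \<kappa> u = 0\<close> and Sturm comparison\<close>

text \<open>
The iteration below integrates twice. Measured against \<open>exp (2 * M * s)\<close>, each integration gains
a factor \<open>1 / (2 * M)\<close>, while multiplication by \<open>\<kappa>\<close> costs at most \<open>M\<close>; so one step is a contraction on an
interval of any length.
\<close>

lemma abs_integral_le_exp:
  fixes f :: "real \<Rightarrow> real"
  assumes M: "1 \<le> M" and A: "0 \<le> A" and f: "continuous_on {0..\<theta>} f"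
    and fb: "\<And>s. s \<in> {0..\<theta>} \<Longrightarrow> \<bar>f s\<bar> \<le> A * exp (2 * M * s)" and s: "s \<in> {0..\<theta>}"
  shows "\<bar>integral {0..s} f\<bar> \<le> A / (2 * M) * exp (2 * M * s)"
proof -
  have fs: "continuous_on {0..s} f"
    using f by (rule continuous_on_subset) (use s in auto)
  have *: "((\<lambda>r. A * exp (2 * M * r)) has_integral
      A / (2 * M) * exp (2 * M * s) - A / (2 * M) * exp (2 * M * 0)) {0..s}"
    using s M
    by (intro fundamental_theorem_of_calculus)
       (auto intro!: derivative_eq_intros simp flip: has_real_derivative_iff_has_vector_derivative)
  have "norm (integral {0..s} f) \<le> integral {0..s} (\<lambda>r. A * exp (2 * M * r))"
    using fb s by (intro integral_norm_bound_integral integrable_continuous_real[OF fs]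
        has_integral_integrable[OF *]) auto
  also have "\<dots> \<le> A / (2 * M) * exp (2 * M * s)"
    using integral_unique[OF *] A M by simp
  finally show ?thesis by simp
qed

text \<open>
The terms of the Picard series: the solution of \<open>u'' + \<kappa> u = 0\<close>, \<open>u 0 = 0\<close>, \<open>u' 0 = 1\<close> is the sum of all
\<open>picard \<kappa> n\<close>, because the second derivative of each further term is \<open>- \<kappa>\<close> times the previous one and
that of the first is \<open>0\<close>.
\<close>

fun picard :: "(real \<Rightarrow> real) \<Rightarrow> nat \<Rightarrow> real \<Rightarrow> real" where
  "picard \<kappa> 0 = (\<lambda>s. s)"
| "picard \<kappa> (Suc n) = (\<lambda>s. integral {0..s} (\<lambda>r. - integral {0..r} (\<lambda>q. \<kappa> q * picard \<kappa> n q)))"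

text \<open>
Existence matters because \<^const>\<open>sn\<close> is a Hilbert choice. The series of the terms and those of their first
and second derivatives are dominated by geometric series, so differentiation may be done termwise.
\<close>

lemma sn_solution_exists:
  fixes \<kappa> :: "real \<Rightarrow> real"
  assumes \<theta>: "0 \<le> \<theta>" and cont: "continuous_on {0..\<theta>} \<kappa>"
  shows "\<exists>u. sn_solution {0..\<theta>} \<kappa> u"
proof -
  (* F n is the n-th term, G n its derivative and H n the derivative of G n. *)
  define F where "F = picard \<kappa>"
  define G where "G n s = (case n of 0 \<Rightarrow> 1 | Suc m \<Rightarrow> - integral {0..s} (\<lambda>q. \<kappa> q * F m q))" for n s
  define H where "H n s = (case n of 0 \<Rightarrow> 0 | Suc m \<Rightarrow> - (\<kappa> s * F m s))" for n s
  have "bounded (\<kappa> ` {0..\<theta>})"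
    using compact_continuous_image[OF cont] by (simp add: compact_imp_bounded)
  then obtain M0 where M0: "\<And>s. s \<in> {0..\<theta>} \<Longrightarrow> \<bar>\<kappa> s\<bar> \<le> M0"
    unfolding bounded_iff by fastforce
  define M where "M = max 1 M0"
  have M: "1 \<le> M" and bound: "\<And>s. s \<in> {0..\<theta>} \<Longrightarrow> \<bar>\<kappa> s\<bar> \<le> M"
    using M0 by (auto simp: M_def le_max_iff_disj)
  have FSuc: "F (Suc n) s = integral {0..s} (G (Suc n))" for n s
    by (simp add: F_def G_def[abs_def])
  have GSuc: "G (Suc n) s = - integral {0..s} (\<lambda>q. \<kappa> q * F n q)" for n s
    by (simp add: G_def)
  have Fcont: "continuous_on {0..\<theta>} (F n)" for n
  proof (induction n)
    case 0
    show ?case by (simp add: F_def)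
  next
    case (Suc n)
    have "continuous_on {0..\<theta>} (G (Suc n))"
      unfolding GSuc using cont Suc
      by (intro continuous_intros indefinite_integral_continuous_1 integrable_continuous_real)
    then show ?case
      unfolding FSuc by (intro indefinite_integral_continuous_1 integrable_continuous_real)
  qed
  have \<kappa>F: "continuous_on {0..\<theta>} (\<lambda>s. \<kappa> s * F n s)" for n
    by (intro continuous_intros cont Fcont)
  have G': "(G n has_real_derivative H n s) (at s within {0..\<theta>})" if "s \<in> {0..\<theta>}" for n s
  proof (cases n)
    case 0
    then show ?thesis by (simp add: G_def[abs_def] H_def)
  next
    case (Suc m)
    show ?thesis
      unfolding Suc G_def[abs_def] H_def nat.case
      by (intro DERIV_minus integral_has_real_derivative \<kappa>F that)
  qed
  have Gcont: "continuous_on {0..\<theta>} (G n)" for n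
    using G' by (meson DERIV_continuous continuous_on_eq_continuous_within)
  have F': "(F n has_real_derivative G n s) (at s within {0..\<theta>})" if "s \<in> {0..\<theta>}" for n s
  proof (cases n)
    case 0
    then show ?thesis by (simp add: F_def G_def)
  next
    case (Suc m)
    show ?thesis
      unfolding Suc FSuc[abs_def] by (intro integral_has_real_derivative Gcont that)
  qed
  have Fb: "\<bar>F n s\<bar> \<le> (1/4) ^ n * exp (2 * M * s)"
    and GSb: "\<bar>G (Suc n) s\<bar> \<le> (1/4) ^ n * (1/2) * exp (2 * M * s)" if "s \<in> {0..\<theta>}" for n s
  proof -
    have GS: "\<bar>G (Suc n) s\<bar> \<le> (1/4) ^ n * (1/2) * exp (2 * M * s)" 
      if s: "s \<in> {0..\<theta>}" and IH: "\<And>s. s \<in> {0..\<theta>} \<Longrightarrow> \<bar>F n s\<bar> \<le> (1/4) ^ n * exp (2 * M * s)" for n s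
    proof -
      have "\<bar>\<kappa> q * F n q\<bar> \<le> M * (1/4) ^ n * exp (2 * M * q)" if "q \<in> {0..\<theta>}" for q
        using mult_mono[OF bound[OF that] IH[OF that]] M by (simp add: abs_mult mult.assoc)
      from abs_integral_le_exp[OF M _ \<kappa>F this s] M
      show ?thesis by (simp add: GSuc)
    qed
    have FB: "\<bar>F n s\<bar> \<le> (1/4) ^ n * exp (2 * M * s)" if "s \<in> {0..\<theta>}" for n s
      using that
    proof (induction n arbitrary: s)
      case 0
      have "s \<le> 2 * M * s"
        using 0 M mult_right_mono[of 1 "2 * M" s] by simp
      also have "\<dots> \<le> exp (2 * M * s)"
        using exp_ge_add_one_self[of "2 * M * s"] by linarith
      finally show ?case using 0 by (simp add: F_def)
    next
      case (Suc n)
      have "\<bar>integral {0..s} (G (Suc n))\<bar> \<le> (1/4) ^ n * (1/2) / (2 * M) * exp (2 * M * s)"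
        by (intro abs_integral_le_exp[OF M _ Gcont GS] Suc) auto
      also have "\<dots> \<le> (1/4) ^ n * (1/2) / 2 * exp (2 * M * s)"
        using M by (intro mult_right_mono divide_left_mono) auto
      finally show ?case by (simp add: FSuc)
    qed
    show "\<bar>F n s\<bar> \<le> (1/4) ^ n * exp (2 * M * s)" using FB that by blast
    show "\<bar>G (Suc n) s\<bar> \<le> (1/4) ^ n * (1/2) * exp (2 * M * s)" using GS FB that by blast
  qed
  define E where "E = exp (2 * M * \<theta>)"
  have E: "exp (2 * M * s) \<le> E" "1 \<le> E" if "s \<in> {0..\<theta>}" for s
    using that M \<theta> by (auto simp: E_def)
  have Fb': "\<bar>F n s\<bar> \<le> (1/4) ^ n * E" if "s \<in> {0..\<theta>}" for n s
    by (rule order_trans[OF Fb[OF that]]) (use E[OF that] in auto)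
  have Gb': "\<bar>G n s\<bar> \<le> (1/4) ^ n * (2 * E)" if "s \<in> {0..\<theta>}" for n s
  proof (cases n)
    case 0
    then show ?thesis using E[OF that] by (simp add: G_def)
  next
    case (Suc m)
    have "\<bar>G (Suc m) s\<bar> \<le> (1/4) ^ m * (1/2) * E"
      by (rule order_trans[OF GSb[OF that]]) (use E[OF that] in auto)
    then show ?thesis by (simp add: Suc mult.commute)
  qed
  have Hb': "\<bar>H n s\<bar> \<le> (1/4) ^ n * (4 * M * E)" if "s \<in> {0..\<theta>}" for n s
  proof (cases n)
    case 0
    then show ?thesis using E[OF that] M by (simp add: H_def)
  next
    case (Suc m)
    have "\<bar>H (Suc m) s\<bar> \<le> M * ((1/4) ^ m * E)"
      using mult_mono[OF bound[OF that] Fb'[OF that, of m]] M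
      by (simp add: H_def abs_mult)
    then show ?thesis by (simp add: Suc mult_ac)
  qed
  have geo: "summable (\<lambda>n. (1/4) ^ n * c)" for c :: real
    by (intro summable_mult2 summable_geometric) simp
  have ucG: "uniformly_convergent_on {0..\<theta>} (\<lambda>n s. \<Sum>i<n. G i s)"
    by (rule Weierstrass_m_test'[OF _ geo]) (use Gb' in auto)
  have ucH: "uniformly_convergent_on {0..\<theta>} (\<lambda>n s. \<Sum>i<n. H i s)"
    by (rule Weierstrass_m_test'[OF _ geo]) (use Hb' in auto)
  have zero: "0 \<in> {0..\<theta>}" using \<theta> by simp
  have sumF: "summable (\<lambda>n. F n s)" if "s \<in> {0..\<theta>}" for s
    by (rule summable_comparison_test'[OF geo[of E], of 0]) (use Fb'[OF that] in auto)
  have sumG: "summable (\<lambda>n. G n s)" if "s \<in> {0..\<theta>}" for s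
    by (rule summable_comparison_test'[OF geo[of "2 * E"], of 0]) (use Gb'[OF that] in auto)
  obtain u where u: "\<And>s. s \<in> {0..\<theta>} \<Longrightarrow> (\<lambda>n. F n s) sums u s \<and>
      (u has_real_derivative (\<Sum>n. G n s)) (at s within {0..\<theta>})"
    using has_field_derivative_series[OF _ F' uniform_limit_suminf[OF ucG] zero sumF[OF zero]]
    by (auto simp del: atLeastAtMost_iff)
  obtain w where w: "\<And>s. s \<in> {0..\<theta>} \<Longrightarrow> (\<lambda>n. G n s) sums w s \<and>
      (w has_real_derivative (\<Sum>n. H n s)) (at s within {0..\<theta>})"
    using has_field_derivative_series[OF _ G' uniform_limit_suminf[OF ucH] zero sumG[OF zero]]
    by (auto simp del: atLeastAtMost_iff)
  have wG: "(\<Sum>n. G n s) = w s" if "s \<in> {0..\<theta>}" for s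
    using w[OF that] by (simp add: sums_iff)
  have uH: "(\<Sum>n. H n s) = - (\<kappa> s * u s)" if "s \<in> {0..\<theta>}" for s
  proof -
    have "(\<lambda>n. - (\<kappa> s * F n s)) sums - (\<kappa> s * u s)"
      using u[OF that] by (intro sums_minus sums_mult) auto
    then have "(\<lambda>n. H (Suc n) s) sums - (\<kappa> s * u s)"
      by (simp add: H_def)
    then have "(\<lambda>n. H n s) sums - (\<kappa> s * u s)"
      by (subst (asm) sums_Suc_iff) (simp add: H_def)
    then show ?thesis by (simp add: sums_iff)
  qed
  have "F n 0 = 0" for n
    by (cases n) (auto simp: F_def)
  then have "u 0 = 0"
    using u[OF zero] by (simp add: sums_iff)
  moreover have "G n 0 = (if n = 0 then 1 else 0)" for n
    by (cases n) (auto simp: G_def)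
  then have "w 0 = 1"
    using w[OF zero] sums_single[of 0 "\<lambda>_. 1::real"] by (auto simp: sums_iff)
  ultimately have "sn_solution {0..\<theta>} \<kappa> u"
    unfolding sn_solution_def using u w uH wG by (intro exI[of _ w]) auto
  then show ?thesis by blast
qed

lemma sn_is_solution:
  assumes "0 \<le> \<theta>" "continuous_on {0..\<theta>} \<kappa>"
  shows "sn_solution {0..\<theta>} \<kappa> (sn {0..\<theta>} \<kappa>)"
  unfolding sn_def using sn_solution_exists[OF assms] by (rule someI_ex)

text \<open>
Sturm's argument: the Wronskian \<open>W = u' v - u v'\<close> vanishes at \<open>0\<close> and has derivative
\<open>(\<mu> - \<kappa>) u v\<close>, so it is nonnegative as long as \<open>u\<close> and \<open>v\<close> are positive, and \<open>(u / v)' = W / v\<^sup>2\<close>.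
\<close>

lemma sturm_quotient_mono:
  fixes \<kappa> \<mu> :: "real \<Rightarrow> real"
  assumes u: "sn_solution {0..\<theta>} \<kappa> u" and v: "sn_solution {0..\<theta>} \<mu> v"
    and le: "\<And>s. s \<in> {0..\<theta>} \<Longrightarrow> \<kappa> s \<le> \<mu> s"
    and vpos: "\<And>s. s \<in> {0<..\<theta>} \<Longrightarrow> v s > 0"
    and upos: "\<And>s. 0 < s \<Longrightarrow> s < b \<Longrightarrow> u s > 0"
    and ab: "0 < a" "a \<le> b" "b \<le> \<theta>"
  shows "u a / v a \<le> u b / v b"
proof -
  obtain u' where u': "u 0 = 0" "u' 0 = 1"
     "\<And>s. s \<in> {0..\<theta>} \<Longrightarrow> (u has_real_derivative u' s) (at s within {0..\<theta>})"
     "\<And>s. s \<in> {0..\<theta>} \<Longrightarrow> (u' has_real_derivative - (\<kappa> s * u s)) (at s within {0..\<theta>})"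
    using u unfolding sn_solution_def by blast
  obtain v' where v': "v 0 = 0" "v' 0 = 1"
     "\<And>s. s \<in> {0..\<theta>} \<Longrightarrow> (v has_real_derivative v' s) (at s within {0..\<theta>})"
     "\<And>s. s \<in> {0..\<theta>} \<Longrightarrow> (v' has_real_derivative - (\<mu> s * v s)) (at s within {0..\<theta>})"
    using v unfolding sn_solution_def by blast
  define W where "W s = u' s * v s - u s * v' s" for s
  have at: "at s within {0..\<theta>} = at s" if "0 < s" "s < \<theta>" for s
    using that by (intro at_within_interior) auto
  have W': "(W has_real_derivative (\<mu> s - \<kappa> s) * u s * v s) (at s within {0..\<theta>})"
    if "s \<in> {0..\<theta>}" for s
    unfolding W_def[abs_def]
    by (rule derivative_eq_intros u'(3,4)[OF that] v'(3,4)[OF that] refl)+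
       (simp add: algebra_simps)
  have Wcont: "continuous_on {0..\<theta>} W"
    using W' by (meson DERIV_continuous continuous_on_eq_continuous_within)
  have W: "0 \<le> W s" if s: "0 \<le> s" "s < b" for s
  proof -
    have "W 0 \<le> W s"
    proof (rule DERIV_nonneg_imp_increasing_open[OF s(1)])
      fix x assume x: "0 < x" "x < s"
      have "0 \<le> (\<mu> x - \<kappa> x) * u x * v x"
        using x s ab le[of x] vpos[of x] upos[of x] by (intro mult_nonneg_nonneg) auto
      then show "\<exists>y. (W has_real_derivative y) (at x) \<and> 0 \<le> y"
        using W'[of x] x s ab at[of x] by auto
    next
      show "continuous_on {0..s} W"
        by (rule continuous_on_subset[OF Wcont]) (use s ab in auto)
    qed
    then show ?thesis by (simp add: W_def u' v')
  qed
  have cu: "continuous_on {0..\<theta>} u" and cv: "continuous_on {0..\<theta>} v"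
    using u'(3) v'(3) by (meson DERIV_continuous continuous_on_eq_continuous_within)+
  show ?thesis
  proof (rule DERIV_nonneg_imp_increasing_open[OF ab(2)])
    fix x assume x: "a < x" "x < b"
    have vx: "v x > 0" using vpos x ab by auto
    have "((\<lambda>s. u s / v s) has_real_derivative (u' x * v x - u x * v' x) / (v x * v x)) (at x)"
      using u'(3)[of x] v'(3)[of x] at[of x] x ab vx by (intro DERIV_divide) auto
    moreover have "0 \<le> (u' x * v x - u x * v' x) / (v x * v x)"
      using W[of x] x ab vx by (simp add: W_def)
    ultimately show "\<exists>y. ((\<lambda>s. u s / v s) has_real_derivative y) (at x) \<and> 0 \<le> y" by blast
  next
    show "continuous_on {a..b} (\<lambda>s. u s / v s)"
      using vpos ab by (intro continuous_intros continuous_on_subset[OF cu] continuous_on_subset[OF cv])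
        (auto simp: less_imp_neq[symmetric] dest!: order.strict_trans2[of 0 a])
  qed
qed

text \<open>
At a first zero \<open>b\<close> of \<open>u\<close> the quotient \<open>u / v\<close> would be \<open>0\<close>, although it is positive before and
nondecreasing up to \<open>b\<close>.
\<close>

lemma sturm_positive:
  fixes \<kappa> \<mu> :: "real \<Rightarrow> real"
  assumes u: "sn_solution {0..\<theta>} \<kappa> u" and v: "sn_solution {0..\<theta>} \<mu> v"
    and le: "\<And>s. s \<in> {0..\<theta>} \<Longrightarrow> \<kappa> s \<le> \<mu> s"
    and vpos: "\<And>s. s \<in> {0<..\<theta>} \<Longrightarrow> v s > 0"
    and s: "s \<in> {0<..\<theta>}"
  shows "u s > 0"
proof (rule ccontr)
  assume neg: "\<not> u s > 0"
  obtain u' where u': "u 0 = 0" "u' 0 = 1"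
     "\<And>s. s \<in> {0..\<theta>} \<Longrightarrow> (u has_real_derivative u' s) (at s within {0..\<theta>})"
    using u unfolding sn_solution_def by blast
  have cu: "continuous_on {0..\<theta>} u"
    using u'(3) by (meson DERIV_continuous continuous_on_eq_continuous_within)
  obtain d where d: "d > 0" "\<And>h. 0 + h \<in> {0..\<theta>} \<Longrightarrow> h > 0 \<Longrightarrow> h < d \<Longrightarrow> u 0 < u (0 + h)"
    using has_real_derivative_pos_inc_right[OF u'(3)[of 0]] s u'(2) by auto
  (* u is positive on the interval from 0 to d, so a first zero in Z is bounded away from 0. *)
  define Z where "Z = {x \<in> {min (d/2) s..\<theta>}. u x \<in> {..0}}"
  have "s \<in> Z" using s neg by (auto simp: Z_def)
  have "closed Z"
    unfolding Z_def by (rule continuous_closed_preimage[OF continuous_on_subset[OF cu], unfolded vimage_def Int_def, simplified]) (use s d in \<open>auto simp: min_le_iff_disj\<close>)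
  define b where "b = Inf Z"
  have bdd: "bdd_below Z" by (auto simp: Z_def bdd_below_def)
  have "b \<in> Z"
    unfolding b_def using \<open>s \<in> Z\<close> \<open>closed Z\<close> bdd by (intro closed_contains_Inf) auto
  then have b: "b \<le> \<theta>" "u b \<le> 0" "min (d/2) s \<le> b"
    by (auto simp: Z_def)
  have b0: "b > 0" using b(3) d s by (auto simp: min_def split: if_splits)
  have pos: "u x > 0" if x: "0 < x" "x < b" for x
  proof (cases "min (d/2) s \<le> x")
    case True
    have "x \<notin> Z" using x bdd cInf_lower[of x Z] by (auto simp: b_def)
    then show ?thesis using True x b by (auto simp: Z_def)
  next
    case False
    then show ?thesis using d(2)[of x] x s b u'(1) d(1) by (auto simp: min_def split: if_splits)
  qed
  have "u (b/2) / v (b/2) \<le> u b / v b"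
    using b0 b pos by (intro sturm_quotient_mono[OF u v le vpos]) auto
  moreover have "u (b/2) / v (b/2) > 0"
    using b0 b pos[of "b/2"] vpos[of "b/2"] by auto
  moreover have "u b / v b \<le> 0"
    using b0 b vpos[of b] by (auto simp: divide_nonpos_pos)
  ultimately show False by linarith
qed

lemma sn_solution_hyperbolic:
  assumes "K \<le> 0"
  shows "sn_solution I (\<lambda>_. K) (\<lambda>s. if K = 0 then s else sinh (sqrt (- K) * s) / sqrt (- K))"
proof (cases "K = 0")
  case True
  then show ?thesis
    unfolding sn_solution_def by (intro exI[of _ "\<lambda>_. 1"]) (auto intro!: derivative_eq_intros)
next
  case False
  define c where "c = sqrt (- K)"
  have c: "c > 0" "K = - (c * c)" using assms False by (auto simp: c_def)
  show ?thesis
    unfolding sn_solution_def c_def[symmetric] using c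
    by (intro exI[of _ "\<lambda>s. cosh (c * s)"]) (auto intro!: derivative_eq_intros)
qed

text \<open>
For constant nonpositive curvature \<open>- c\<^sup>2\<close> the solution is unique because \<open>(u' + d u) exp (- d s)\<close> is constant for \<open>d = c\<close> and
for \<open>d = - c\<close>. Adding the two identities gives \<open>u'\<close> without dividing by \<open>c\<close>, which may be \<open>0\<close>.
\<close>

lemma cn_eq_cosh:
  assumes "K \<le> 0"
  shows "cn K s = cosh (sqrt (- K) * s)"
proof -
  define c where "c = sqrt (- K)"
  have K: "K = - (c * c)" using assms by (auto simp: c_def)
  define u where "u = sn UNIV (\<lambda>_. K)"
  have "sn_solution UNIV (\<lambda>_. K) u"
    unfolding u_def sn_def
    using sn_solution_hyperbolic[OF assms] someI_ex[of "sn_solution UNIV (\<lambda>_. K)"] by blast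
  then obtain u' where u': "u 0 = 0" "u' 0 = 1"
     "\<And>s. (u has_real_derivative u' s) (at s)"
     "\<And>s. (u' has_real_derivative (c * c * u s)) (at s)"
    unfolding sn_solution_def K by auto
  have *: "(u' s + d * u s) * exp (- d * s) = 1" if "d * d = c * c" for d s
  proof -
    have "((\<lambda>s. (u' s + d * u s) * exp (- d * s)) has_real_derivative
        (c * c * u s + d * u' s) * exp (- d * s) + (u' s + d * u s) * (- d * exp (- d * s))) (at s)" for s
      by (auto intro!: derivative_eq_intros u'(3,4))
    moreover have "(c * c * u s + d * u' s) * exp (- d * s) + (u' s + d * u s) * (- d * exp (- d * s)) = 0" for s
      by (simp add: that[symmetric] algebra_simps)
    ultimately have "\<forall>s. ((\<lambda>s. (u' s + d * u s) * exp (- d * s)) has_real_derivative 0) (at s)"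
      by simp
    from DERIV_isconst_all[OF this, of s 0] show ?thesis by (simp add: u')
  qed
  have **: "u' s + d * u s = exp (d * s)" if "d * d = c * c" for d
    using *[OF that, of s] by (simp add: exp_minus field_simps)
  have "u' s = cosh (c * s)"
    using **[of c] **[of "- c"] by (simp add: cosh_def)
  then show ?thesis
    unfolding cn_def u_def[symmetric] c_def[symmetric]
    using u'(3) by (metis DERIV_imp_deriv)
qed

section \<open>Lower bounds for the distortion coefficients\<close>

text \<open>
Monotonicity in the curvature is what makes the sequence in the definition of \<^const>\<open>sigma\<close> converge.
\<close>

lemma sigma_cont_mono:
  assumes \<theta>: "0 < \<theta>" and t: "t \<in> {0<..1}"
    and \<kappa>: "continuous_on {0..\<theta>} \<kappa>" and \<mu>: "continuous_on {0..\<theta>} \<mu>"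
    and le: "\<And>s. s \<in> {0..\<theta>} \<Longrightarrow> \<kappa> s \<le> \<mu> s"
  shows "sigma_cont t \<kappa> \<theta> \<le> sigma_cont t \<mu> \<theta>"
proof (cases "\<forall>s\<in>{0<..\<theta>}. sn {0..\<theta>} \<mu> s > 0")
  case True
  note u = sn_is_solution[OF less_imp_le[OF \<theta>] \<kappa>]
  note v = sn_is_solution[OF less_imp_le[OF \<theta>] \<mu>]
  have pos: "sn {0..\<theta>} \<kappa> s > 0" if "s \<in> {0<..\<theta>}" for s
    using sturm_positive[OF u v le] True that by blast
  have t\<theta>: "0 < t * \<theta>" "t * \<theta> \<le> \<theta>" using t \<theta> by auto
  have "sn {0..\<theta>} \<kappa> (t * \<theta>) / sn {0..\<theta>} \<mu> (t * \<theta>) \<le> sn {0..\<theta>} \<kappa> \<theta> / sn {0..\<theta>} \<mu> \<theta>"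
    using True pos t\<theta> by (intro sturm_quotient_mono[OF u v le]) auto
  then have "sn {0..\<theta>} \<kappa> (t * \<theta>) / sn {0..\<theta>} \<kappa> \<theta> \<le> sn {0..\<theta>} \<mu> (t * \<theta>) / sn {0..\<theta>} \<mu> \<theta>"
    using True pos[of \<theta>] t\<theta> \<theta> by (auto simp: field_simps)
  then show ?thesis
    using True pos by (auto simp: sigma_cont_def intro!: ennreal_leI)
next
  case False
  then show ?thesis by (auto simp: sigma_cont_def)
qed

text \<open>
Comparison with constant curvature \<open>K\<close> gives \<open>sinh (c \<theta> / 2) / sinh (c \<theta>) = 1 / (2 cosh (c \<theta> / 2))\<close> with
\<open>c = sqrt (- K)\<close>. Replacing \<open>\<theta> / 2\<close> by \<open>\<theta>\<close> in the last term loses something, but the doubling constant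
is stated with the full diameter.
\<close>

lemma sigma_cont_half_lower:
  assumes \<theta>: "0 < \<theta>" and \<kappa>: "continuous_on {0..\<theta>} \<kappa>" and K: "K \<le> 0"
    and le: "\<And>s. s \<in> {0..\<theta>} \<Longrightarrow> K \<le> \<kappa> s"
  shows "ennreal (1 / (2 * cosh (sqrt (- K) * \<theta>))) \<le> sigma_cont (1/2) \<kappa> \<theta>"
proof (cases "\<forall>s\<in>{0<..\<theta>}. sn {0..\<theta>} \<kappa> s > 0")
  case True
  define v where "v = sn {0..\<theta>} \<kappa>"
  define u where "u s = (if K = 0 then s else sinh (sqrt (- K) * s) / sqrt (- K))" for s
  have v: "sn_solution {0..\<theta>} \<kappa> v"
    unfolding v_def by (rule sn_is_solution[OF less_imp_le[OF \<theta>] \<kappa>])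
  have u: "sn_solution {0..\<theta>} (\<lambda>_. K) u"
    unfolding u_def[abs_def] by (rule sn_solution_hyperbolic[OF K])
  have upos: "u s > 0" if "s > 0" for s
    using that K by (auto simp: u_def zero_less_mult_iff zero_less_divide_iff)
  have "u (\<theta>/2) / v (\<theta>/2) \<le> u \<theta> / v \<theta>"
    using True \<theta> upos by (intro sturm_quotient_mono[OF u v le]) (auto simp: v_def)
  then have "u (\<theta>/2) / u \<theta> \<le> v (\<theta>/2) / v \<theta>"
    using True \<theta> upos[of \<theta>] by (auto simp: v_def field_simps)
  moreover have "1 / (2 * cosh (sqrt (- K) * \<theta>)) \<le> u (\<theta>/2) / u \<theta>"
  proof (cases "K = 0")
    case True
    then show ?thesis using \<theta> by (simp add: u_def)
  next
    case False
    define a where "a = sqrt (- K) * \<theta> / 2"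
    have a: "a > 0" using False K \<theta> by (simp add: a_def)
    have "u (\<theta>/2) / u \<theta> = sinh a / sinh (2 * a)"
      using False K by (simp add: u_def a_def)
    also have "\<dots> = 1 / (2 * cosh a)"
      using a by (simp add: sinh_double)
    finally have "u (\<theta>/2) / u \<theta> = 1 / (2 * cosh a)" .
    moreover have "cosh a \<le> cosh (2 * a)"
      using a by (subst cosh_real_nonneg_le_iff) auto
    moreover have "2 * a = sqrt (- K) * \<theta>" by (simp add: a_def)
    ultimately show ?thesis
      by (simp add: frac_le)
  qed
  ultimately show ?thesis
    using True by (auto simp: sigma_cont_def v_def intro!: ennreal_leI)
next
  case False
  then show ?thesis by (auto simp: sigma_cont_def)
qed

text \<open>
The lower bound on \<open>\<kappa>\<close> keeps the infimum in \<^const>\<open>lipschitz_approx\<close> finite. The approximations are then Lipschitz, hence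
continuous, as existence and comparison of solutions require.
\<close>

lemma
  fixes \<kappa> :: "real \<Rightarrow> real"
  assumes \<theta>: "0 \<le> \<theta>" and K: "\<And>s. s \<in> {0..\<theta>} \<Longrightarrow> K \<le> \<kappa> s"
  shows lipschitz_approx_ge: "K \<le> lipschitz_approx \<kappa> \<theta> n s"
    and lipschitz_approx_Suc: "lipschitz_approx \<kappa> \<theta> n s \<le> lipschitz_approx \<kappa> \<theta> (Suc n) s"
    and continuous_on_lipschitz_approx: "continuous_on A (lipschitz_approx \<kappa> \<theta> n)"
proof -
  have ne: "{0..\<theta>} \<noteq> {}" using \<theta> by auto
  have K': "K \<le> \<kappa> r + real n * \<bar>s - r\<bar>" if "r \<in> {0..\<theta>}" for r n s
    using K[OF that] by (simp add: add_increasing2)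
  have bdd: "bdd_below ((\<lambda>r. \<kappa> r + real n * \<bar>s - r\<bar>) ` {0..\<theta>})" for n s
    using K' by (intro bdd_belowI[of _ K]) blast
  show "K \<le> lipschitz_approx \<kappa> \<theta> n s"
    unfolding lipschitz_approx_def using ne K' by (intro cINF_greatest) auto
  show "lipschitz_approx \<kappa> \<theta> n s \<le> lipschitz_approx \<kappa> \<theta> (Suc n) s"
    unfolding lipschitz_approx_def
    by (rule cINF_mono[OF ne bdd]) (auto intro!: bexI mult_right_mono)
  have L: "lipschitz_approx \<kappa> \<theta> n s \<le> lipschitz_approx \<kappa> \<theta> n s' + real n * \<bar>s - s'\<bar>" for s s'
  proof -
    have "lipschitz_approx \<kappa> \<theta> n s - real n * \<bar>s - s'\<bar> \<le> lipschitz_approx \<kappa> \<theta> n s'"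
      unfolding lipschitz_approx_def[of _ _ _ s']
    proof (rule cINF_greatest[OF ne])
      fix r assume r: "r \<in> {0..\<theta>}"
      have "lipschitz_approx \<kappa> \<theta> n s \<le> \<kappa> r + real n * \<bar>s - r\<bar>"
        unfolding lipschitz_approx_def by (rule cINF_lower[OF bdd r])
      also have "\<dots> \<le> \<kappa> r + real n * (\<bar>s - s'\<bar> + \<bar>s' - r\<bar>)"
        by (intro add_left_mono mult_left_mono) auto
      finally show "lipschitz_approx \<kappa> \<theta> n s - real n * \<bar>s - s'\<bar> \<le> \<kappa> r + real n * \<bar>s' - r\<bar>"
        by (simp add: algebra_simps)
    qed
    then show ?thesis by simp
  qed
  have "(real n)-lipschitz_on A (lipschitz_approx \<kappa> \<theta> n)"
  proof (rule lipschitz_onI)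
    fix s s'
    show "dist (lipschitz_approx \<kappa> \<theta> n s) (lipschitz_approx \<kappa> \<theta> n s') \<le> real n * dist s s'"
      using L[of s s'] L[of s' s] by (simp add: dist_real_def abs_minus_commute)
  qed simp
  then show "continuous_on A (lipschitz_approx \<kappa> \<theta> n)"
    by (rule lipschitz_on_continuous_on)
qed

lemma sigma_half_lower:
  fixes \<kappa> :: "real \<Rightarrow> real"
  assumes \<theta>: "0 < \<theta>" and K: "K \<le> 0" and le: "\<And>s. s \<in> {0..\<theta>} \<Longrightarrow> K \<le> \<kappa> s"
  shows "ennreal (1 / (2 * cosh (sqrt (- K) * \<theta>))) \<le> sigma (1/2) \<kappa> \<theta>"
proof -
  define f where "f n = sigma_cont (1/2) (lipschitz_approx \<kappa> \<theta> n) \<theta>" for n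
  note \<theta>0 = less_imp_le[OF \<theta>]
  note c = continuous_on_lipschitz_approx[OF \<theta>0 le]
  have "mono f"
    unfolding f_def mono_iff_le_Suc
    by (intro allI sigma_cont_mono[OF \<theta> _ c c] lipschitz_approx_Suc[OF \<theta>0 le]) auto
  then have lim: "lim f = (SUP n. f n)"
    by (intro limI LIMSEQ_SUP)
  have "ennreal (1 / (2 * cosh (sqrt (- K) * \<theta>))) \<le> f 0"
    unfolding f_def
    by (intro sigma_cont_half_lower[OF \<theta> c K] lipschitz_approx_ge[OF \<theta>0 le])
  also have "\<dots> \<le> (SUP n. f n)" by (rule SUP_upper) simp
  finally show ?thesis
    using \<theta> lim by (simp add: sigma_def f_def[abs_def])
qed

text \<open>
In the case \<open>N = 1\<close> the exponent is \<open>0\<close> and the bound reads \<open>1/2 \<le> tau\<close>. It needs \<open>\<theta> > 0\<close>: at \<open>\<theta> = 0\<close> the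
coefficient \<open>\<theta> * \<infinity>\<close> vanishes wherever the curvature is positive.
\<close>

lemma tau_half_lower:
  fixes \<kappa> :: "real \<Rightarrow> real"
  assumes \<theta>: "0 < \<theta>" "\<theta> \<le> L" and N: "1 \<le> N" and K: "K \<le> 0" and le: "\<And>s. s \<in> {0..\<theta>} \<Longrightarrow> K \<le> \<kappa> s"
  shows "ennreal (1/2 * cosh (sqrt (- (K / (N - 1))) * L) powr (- ((N - 1) / N))) \<le> tau N (1/2) \<kappa> \<theta>"
proof (cases "N = 1")
  case True
  then show ?thesis using \<theta> by (auto simp: tau_def ennreal_mult_top ennreal_leI)
next
  case False
  define c where "c = sqrt (- (K / (N - 1)))"
  define p where "p = (N - 1) / N"
  have p: "0 < p" "1 / N = 1 - p" using False N by (auto simp: p_def field_simps)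
  have c: "c \<ge> 0" using False N K by (auto simp: c_def divide_nonpos_pos)
  define \<sigma> where "\<sigma> = sigma (1/2) (\<lambda>s. \<kappa> s / (N - 1)) \<theta>"
  have "ennreal (1 / (2 * cosh (c * \<theta>))) \<le> \<sigma>"
    unfolding c_def \<sigma>_def using False N K le
    by (intro sigma_half_lower \<theta>) (auto simp: divide_nonpos_pos divide_right_mono)
  moreover have "1 / (2 * cosh (c * L)) \<le> 1 / (2 * cosh (c * \<theta>))"
    using c \<theta> by (intro divide_left_mono mult_left_mono) (auto simp: cosh_real_nonneg_le_iff mult_left_mono)
  ultimately have \<sigma>: "ennreal (1 / (2 * cosh (c * L))) \<le> \<sigma>"
    using ennreal_leI order_trans by blast
  have "ennreal ((1 / (2 * cosh (c * L))) powr p) \<le> ennreal_powr \<sigma> p"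
  proof (cases \<sigma>)
    case (real x)
    then show ?thesis using \<sigma> p
      by (auto simp: ennreal_powr_def intro!: ennreal_leI powr_mono2)
  next
    case top
    then show ?thesis by (simp add: ennreal_powr_def)
  qed
  then have "ennreal ((1/2) powr (1 / N)) * ennreal ((1 / (2 * cosh (c * L))) powr p)
      \<le> tau N (1/2) \<kappa> \<theta>"
    using False by (auto simp: tau_def \<sigma>_def p_def intro!: mult_left_mono)
  also have "ennreal ((1/2) powr (1 / N)) * ennreal ((1 / (2 * cosh (c * L))) powr p)
    = ennreal ((1/2) powr (1 / N) * (1 / (2 * cosh (c * L))) powr p)"
    by (simp add: ennreal_mult)
  also have "(1 / (2 * cosh (c * L))) powr p = (1/2) powr p * cosh (c * L) powr (- p)"
    by (simp add: powr_divide powr_mult powr_minus_divide)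
  also have "(1/2) powr (1 / N) * ((1/2) powr p * cosh (c * L) powr (- p))
     = 1/2 * cosh (c * L) powr (- p)"
    unfolding p(2) by (simp add: powr_diff)
  finally show ?thesis by (simp add: c_def p_def)
qed

section \<open>Approximate gluing of couplings\<close>

lemma couplings_sets:
  assumes "\<pi> \<in> couplings \<mu> \<nu>"
  shows "sets \<pi> = sets borel" "prob_space \<pi>" "space \<pi> = UNIV"
    "distr \<pi> borel fst = \<mu>" "distr \<pi> borel snd = \<nu>"
  using assms sets_eq_imp_space_eq[of \<pi> borel] by (auto simp: couplings_def)

lemma borel_measurable_fst_snd [measurable]:
  "(fst :: 'a::topological_space \<times> 'b::topological_space \<Rightarrow> 'a) \<in> borel_measurable borel"
  "(snd :: 'a::topological_space \<times> 'b::topological_space \<Rightarrow> 'b) \<in> borel_measurable borel"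
  by (auto intro!: borel_measurable_continuous_onI continuous_intros)

text \<open>
Separability gives a countable measurable partition into sets of small diameter: a point is sent to the index of the first point of a
dense sequence that is close to it.
\<close>

lemma small_cells:
  fixes \<eta> :: real
  assumes "\<eta> > 0"
  obtains q :: "'a::polish_space \<Rightarrow> nat"
  where "q \<in> measurable borel (count_space UNIV)" "\<And>z z'. q z = q z' \<Longrightarrow> dist z z' < \<eta>"
proof -
  obtain D :: "'a set" where D: "countable D" "\<And>X. open X \<Longrightarrow> X \<noteq> {} \<Longrightarrow> \<exists>d\<in>D. d \<in> X"
    using countable_dense_exists by blast
  have near: "\<exists>d\<in>D. dist z d < \<eta> / 2" for z
    using D(2)[of "ball z (\<eta>/2)"] assms by auto
  define e where "e = from_nat_into D"
  have e: "\<exists>n. dist z (e n) < \<eta> / 2" for z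
    using near[of z] from_nat_into_surj[OF D(1)] by (metis e_def)
  define q where "q z = (LEAST n. dist z (e n) < \<eta> / 2)" for z
  have q: "dist z (e (q z)) < \<eta> / 2" for z
    unfolding q_def by (rule LeastI_ex[OF e])
  show ?thesis
  proof
    show "q \<in> measurable borel (count_space UNIV)"
      unfolding q_def by measurable
    show "dist z z' < \<eta>" if "q z = q z'" for z z'
      using q[of z] q[of z'] that dist_triangle2[of z z' "e (q z)"] by simp
  qed
qed

text \<open>
Exact gluing along the common marginal \<open>\<nu>\<close> would condition on single points, which is a matter of disintegration.
If the two intermediate points may differ by \<open>\<eta>\<close>, one conditions on sets of positive measure instead: cut the
intermediate space into countably many cells of diameter less than \<open>\<eta>\<close> and couple \<open>\<pi>1\<close> and \<open>\<pi>2\<close> independently inside each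
cell. This measure has the density \<open>f = 1 / \<nu> (cell)\<close> with respect to \<open>\<pi>1 \<Otimes>\<^sub>M \<pi>2\<close> where both
intermediate points are in the same cell, and \<open>0\<close> elsewhere.
\<close>

lemma approximate_gluing:
  fixes \<mu> \<nu> \<rho> :: "'a::polish_space measure"
  assumes \<pi>1: "\<pi>1 \<in> couplings \<mu> \<nu>" and \<pi>2: "\<pi>2 \<in> couplings \<nu> \<rho>" and \<eta>: "\<eta> > 0"
  obtains \<Gamma> :: "(('a \<times> 'a) \<times> ('a \<times> 'a)) measure"
  where "sets \<Gamma> = sets borel" "distr \<Gamma> borel fst = \<pi>1" "distr \<Gamma> borel snd = \<pi>2"
    "AE p in \<Gamma>. dist (snd (fst p)) (fst (snd p)) < \<eta>"
proof -
  obtain q :: "'a \<Rightarrow> nat" where q[measurable]: "q \<in> measurable borel (count_space UNIV)"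
    and near: "\<And>z z'. q z = q z' \<Longrightarrow> dist z z' < \<eta>"
    using small_cells[OF \<eta>] by blast
  note p1 = couplings_sets[OF \<pi>1] and p2 = couplings_sets[OF \<pi>2]
  note [measurable_cong] = p1(1) p2(1)
  interpret P1: prob_space \<pi>1 by (rule p1)
  interpret P2: prob_space \<pi>2 by (rule p2)
  interpret P: pair_prob_space \<pi>1 \<pi>2 ..
  define w where "w i = emeasure \<nu> (q -` {i})" for i
  have qi: "q -` {i} \<in> sets borel" for i
    using measurable_sets[OF q, of "{i}"] by simp
  have w1: "w i = emeasure \<pi>1 {p. q (snd p) = i}" for i
    unfolding w_def p1(5)[symmetric]
    by (subst emeasure_distr) (use qi in \<open>auto simp: p1(3) vimage_def intro!: arg_cong[of _ _ "emeasure \<pi>1"]\<close>)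
  have w2: "w i = emeasure \<pi>2 {p. q (fst p) = i}" for i
    unfolding w_def p2(4)[symmetric]
    by (subst emeasure_distr) (use qi in \<open>auto simp: p2(3) vimage_def intro!: arg_cong[of _ _ "emeasure \<pi>2"]\<close>)
  have wfin: "w i < \<infinity>" for i
    unfolding w1 by (simp add: P1.emeasure_finite less_top[symmetric])
  define f :: "('a \<times> 'a) \<times> ('a \<times> 'a) \<Rightarrow> ennreal"
    where "f p = (if q (snd (fst p)) = q (fst (snd p)) then inverse (w (q (snd (fst p)))) else 0)" for p
  have f[measurable]: "f \<in> borel_measurable (\<pi>1 \<Otimes>\<^sub>M \<pi>2)"
  proof -
    have "snd \<in> measurable \<pi>1 borel" "fst \<in> measurable \<pi>2 borel"
      using borel_measurable_fst_snd by (simp_all add: p1(1) p2(1) cong: measurable_cong_sets)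
    from measurable_compose[OF this(1) q] measurable_compose[OF this(2) q]
    have m: "(\<lambda>p. q (snd p)) \<in> measurable \<pi>1 (count_space UNIV)"
      "(\<lambda>p. q (fst p)) \<in> measurable \<pi>2 (count_space UNIV)" .
    have Q: "(\<lambda>p. (q (snd (fst p)), q (fst (snd p)))) \<in> measurable (\<pi>1 \<Otimes>\<^sub>M \<pi>2) (count_space UNIV \<Otimes>\<^sub>M count_space UNIV)"
      by (intro measurable_Pair measurable_compose[OF measurable_fst m(1)]
          measurable_compose[OF measurable_snd m(2)])
    have "(\<lambda>(i, j). if i = j then inverse (w i) else 0)
        \<in> borel_measurable (count_space UNIV \<Otimes>\<^sub>M count_space UNIV :: (nat \<times> nat) measure)"
      by (simp add: pair_measure_countable)
    from measurable_compose[OF Q this] show ?thesis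
      by (simp add: f_def[abs_def])
  qed
  have f1: "f (a, b) = inverse (w (q (snd a))) * indicator {p. q (fst p) = q (snd a)} b" for a b
    by (auto simp: f_def split: split_indicator)
  have f2: "f (a, b) = inverse (w (q (fst b))) * indicator {p. q (snd p) = q (fst b)} a" for a b
    by (auto simp: f_def split: split_indicator)
  have inner1: "(\<integral>\<^sup>+ b. f (a, b) \<partial>\<pi>2) = 1" if "w (q (snd a)) \<noteq> 0" for a
  proof -
    have "(\<integral>\<^sup>+ b. f (a, b) \<partial>\<pi>2) = inverse (w (q (snd a))) * w (q (snd a))"
      unfolding f1 by (subst nn_integral_cmult) (auto simp: w2)
    then show ?thesis
      using that wfin[of "q (snd a)"] by (simp add: ennreal_inverse_mult mult.commute ennreal_divide_self flip: divide_ennreal_def)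
  qed
  have inner2: "(\<integral>\<^sup>+ a. f (a, b) \<partial>\<pi>1) = 1" if "w (q (fst b)) \<noteq> 0" for b
  proof -
    have "(\<integral>\<^sup>+ a. f (a, b) \<partial>\<pi>1) = inverse (w (q (fst b))) * w (q (fst b))"
      unfolding f2 by (subst nn_integral_cmult) (auto simp: w1)
    then show ?thesis
      using that wfin[of "q (fst b)"] by (simp add: mult.commute ennreal_divide_self flip: divide_ennreal_def)
  qed
  have ae1: "AE a in \<pi>1. w (q (snd a)) \<noteq> 0"
  proof -
    have "AE a in \<pi>1. \<forall>i. w i = 0 \<longrightarrow> q (snd a) \<noteq> i"
      unfolding AE_all_countable
    proof
      fix i
      show "AE a in \<pi>1. w i = 0 \<longrightarrow> q (snd a) \<noteq> i"
      proof (cases "w i = 0")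
        case True
        then show ?thesis
          by (intro AE_I[of _ _ "{p. q (snd p) = i}"]) (auto simp: w1 p1(3))
      qed simp
    qed
    then show ?thesis by eventually_elim auto
  qed
  have ae2: "AE b in \<pi>2. w (q (fst b)) \<noteq> 0"
  proof -
    have "AE a in \<pi>2. \<forall>i. w i = 0 \<longrightarrow> q (fst a) \<noteq> i"
      unfolding AE_all_countable
    proof
      fix i
      show "AE a in \<pi>2. w i = 0 \<longrightarrow> q (fst a) \<noteq> i"
      proof (cases "w i = 0")
        case True
        then show ?thesis
          by (intro AE_I[of _ _ "{p. q (fst p) = i}"]) (auto simp: w2 p2(3))
      qed simp
    qed
    then show ?thesis by eventually_elim auto
  qed
  define \<Gamma> where "\<Gamma> = density (\<pi>1 \<Otimes>\<^sub>M \<pi>2) f"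
  have s\<Gamma>: "sets \<Gamma> = sets borel"
    using sets_pair_measure_cong[OF p1(1) p2(1)] unfolding \<Gamma>_def sets_density borel_prod .
  note [measurable_cong] = s\<Gamma>
  show ?thesis
  proof
    show "sets \<Gamma> = sets borel" by (rule s\<Gamma>)
    show "distr \<Gamma> borel fst = \<pi>1"
    proof (rule measure_eqI)
      fix A assume "A \<in> sets (distr \<Gamma> borel fst)"
      then have A[measurable]: "A \<in> sets borel" by simp
      have pre: "fst -` A \<in> sets (\<pi>1 \<Otimes>\<^sub>M \<pi>2)"
        using measurable_sets[OF borel_measurable_fst_snd(1) A] s\<Gamma> by (simp add: \<Gamma>_def)
      have "emeasure (distr \<Gamma> borel fst) A = (\<integral>\<^sup>+ p. f p * indicator A (fst p) \<partial>(\<pi>1 \<Otimes>\<^sub>M \<pi>2))"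
        by (subst emeasure_distr, simp, simp, unfold \<Gamma>_def, subst emeasure_density)
           (auto simp: space_pair_measure p1(3) p2(3) pre split: split_indicator intro!: nn_integral_cong)
      also have "\<dots> = (\<integral>\<^sup>+ a. \<integral>\<^sup>+ b. f (a, b) * indicator A a \<partial>\<pi>2 \<partial>\<pi>1)"
        by (subst P2.nn_integral_fst[symmetric]) auto
      also have "\<dots> = (\<integral>\<^sup>+ a. (\<integral>\<^sup>+ b. f (a, b) \<partial>\<pi>2) * indicator A a \<partial>\<pi>1)"
        by (intro nn_integral_cong nn_integral_multc) auto
      also have "\<dots> = (\<integral>\<^sup>+ a. indicator A a \<partial>\<pi>1)"
        using ae1 by (intro nn_integral_cong_AE) (auto elim!: eventually_mono simp: inner1)
      finally show "emeasure (distr \<Gamma> borel fst) A = emeasure \<pi>1 A" by (simp add: p1(1))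
    qed (simp add: p1)
    show "distr \<Gamma> borel snd = \<pi>2"
    proof (rule measure_eqI)
      fix A assume "A \<in> sets (distr \<Gamma> borel snd)"
      then have A[measurable]: "A \<in> sets borel" by simp
      have pre: "snd -` A \<in> sets (\<pi>1 \<Otimes>\<^sub>M \<pi>2)"
        using measurable_sets[OF borel_measurable_fst_snd(2) A] s\<Gamma> by (simp add: \<Gamma>_def)
      have "emeasure (distr \<Gamma> borel snd) A = (\<integral>\<^sup>+ p. f p * indicator A (snd p) \<partial>(\<pi>1 \<Otimes>\<^sub>M \<pi>2))"
        by (subst emeasure_distr, simp, simp, unfold \<Gamma>_def, subst emeasure_density)
           (auto simp: space_pair_measure p1(3) p2(3) pre split: split_indicator intro!: nn_integral_cong)
      also have "\<dots> = (\<integral>\<^sup>+ b. \<integral>\<^sup>+ a. f (a, b) * indicator A b \<partial>\<pi>1 \<partial>\<pi>2)"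
        by (subst P.nn_integral_snd[symmetric]) auto
      also have "\<dots> = (\<integral>\<^sup>+ b. (\<integral>\<^sup>+ a. f (a, b) \<partial>\<pi>1) * indicator A b \<partial>\<pi>2)"
        by (intro nn_integral_cong nn_integral_multc) auto
      also have "\<dots> = (\<integral>\<^sup>+ a. indicator A a \<partial>\<pi>2)"
        using ae2 by (intro nn_integral_cong_AE) (auto elim!: eventually_mono simp: inner2)
      finally show "emeasure (distr \<Gamma> borel snd) A = emeasure \<pi>2 A" by (simp add: p2(1))
    qed (simp add: p2)
    show "AE p in \<Gamma>. dist (snd (fst p)) (fst (snd p)) < \<eta>"
      unfolding \<Gamma>_def by (subst AE_density) (auto simp: f_def near split: if_splits)
  qed
qed

section \<open>Wasserstein midpoints\<close>

lemma product_in_couplings: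
  assumes \<mu>: "prob_space \<mu>" "sets \<mu> = sets (borel :: 'a::polish_space measure)"
    and \<nu>: "prob_space \<nu>" "sets \<nu> = sets (borel :: 'a measure)"
  shows "\<mu> \<Otimes>\<^sub>M \<nu> \<in> couplings \<mu> \<nu>"
proof -
  interpret \<mu>: prob_space \<mu> by fact
  interpret \<nu>: prob_space \<nu> by fact
  interpret P: pair_prob_space \<mu> \<nu> ..
  have s: "sets (\<mu> \<Otimes>\<^sub>M \<nu>) = sets borel"
    using sets_pair_measure_cong[OF \<mu>(2) \<nu>(2)] unfolding borel_prod .
  have "distr (\<mu> \<Otimes>\<^sub>M \<nu>) borel fst = \<mu>"
  proof (rule measure_eqI)
    fix A assume "A \<in> sets (distr (\<mu> \<Otimes>\<^sub>M \<nu>) borel fst)"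
    then have A: "A \<in> sets \<mu>" using \<mu> by simp
    have "emeasure (distr (\<mu> \<Otimes>\<^sub>M \<nu>) borel fst) A = emeasure (\<mu> \<Otimes>\<^sub>M \<nu>) (A \<times> space \<nu>)"
      using A \<mu>(2) \<nu>(2) sets_eq_imp_space_eq[OF \<mu>(2)] sets_eq_imp_space_eq[OF \<nu>(2)] s
      by (subst emeasure_distr) (auto simp: space_pair_measure cong: measurable_cong_sets intro!: arg_cong[of _ _ "emeasure (\<mu> \<Otimes>\<^sub>M \<nu>)"])
    also have "\<dots> = emeasure \<mu> A"
      using A by (subst \<nu>.emeasure_pair_measure_Times) (auto simp: \<nu>.emeasure_space_1)
    finally show "emeasure (distr (\<mu> \<Otimes>\<^sub>M \<nu>) borel fst) A = emeasure \<mu> A" .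
  qed (use \<mu> in simp)
  moreover have "distr (\<mu> \<Otimes>\<^sub>M \<nu>) borel snd = \<nu>"
  proof (rule measure_eqI)
    fix A assume "A \<in> sets (distr (\<mu> \<Otimes>\<^sub>M \<nu>) borel snd)"
    then have A: "A \<in> sets \<nu>" using \<nu> by simp
    have "emeasure (distr (\<mu> \<Otimes>\<^sub>M \<nu>) borel snd) A = emeasure (\<mu> \<Otimes>\<^sub>M \<nu>) (space \<mu> \<times> A)"
      using A \<mu>(2) \<nu>(2) sets_eq_imp_space_eq[OF \<mu>(2)] sets_eq_imp_space_eq[OF \<nu>(2)] s
      by (subst emeasure_distr) (auto simp: space_pair_measure cong: measurable_cong_sets intro!: arg_cong[of _ _ "emeasure (\<mu> \<Otimes>\<^sub>M \<nu>)"])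
    also have "\<dots> = emeasure \<nu> A"
      using A by (subst \<nu>.emeasure_pair_measure_Times) (auto simp: \<mu>.emeasure_space_1)
    finally show "emeasure (distr (\<mu> \<Otimes>\<^sub>M \<nu>) borel snd) A = emeasure \<nu> A" .
  qed (use \<nu> in simp)
  ultimately show ?thesis
    using s P.prob_space_axioms by (simp add: couplings_def)
qed

lemma transport_cost_finite:
  fixes \<mu> \<nu> :: "'a::polish_space measure"
  assumes \<pi>: "\<pi> \<in> couplings \<mu> \<nu>" and \<mu>: "\<mu> \<in> P2" and \<nu>: "\<nu> \<in> P2"
  shows "transport_cost \<pi> < \<infinity>"
proof -
  note p = couplings_sets[OF \<pi>]
  note [measurable_cong] = p(1)
  interpret prob_space \<pi> by (rule p)
  obtain x0 where x0: "(\<integral>\<^sup>+ x. ennreal ((dist x0 x)\<^sup>2) \<partial>\<mu>) < \<infinity>"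
    using \<mu> by (auto simp: P2_def)
  obtain y0 where y0: "(\<integral>\<^sup>+ x. ennreal ((dist y0 x)\<^sup>2) \<partial>\<nu>) < \<infinity>"
    using \<nu> by (auto simp: P2_def)
  have x1: "(\<integral>\<^sup>+ p. ennreal ((dist x0 (fst p))\<^sup>2) \<partial>\<pi>) < \<infinity>"
    using x0 unfolding p(4)[symmetric] by (subst (asm) nn_integral_distr) auto
  have y1: "(\<integral>\<^sup>+ p. ennreal ((dist y0 (snd p))\<^sup>2) \<partial>\<pi>) < \<infinity>"
    using y0 unfolding p(5)[symmetric] by (subst (asm) nn_integral_distr) auto
  have "transport_cost \<pi> \<le> (\<integral>\<^sup>+ p. 3 * ennreal ((dist x0 (fst p))\<^sup>2) + 3 * ennreal ((dist x0 y0)\<^sup>2)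
      + 3 * ennreal ((dist y0 (snd p))\<^sup>2) \<partial>\<pi>)"
    unfolding transport_cost_def
  proof (rule nn_integral_mono)
    fix p :: "'a \<times> 'a"
    define u where "u = dist x0 (fst p)"
    define v where "v = dist x0 y0"
    define w where "w = dist y0 (snd p)"
    have "dist (fst p) (snd p) \<le> u + v + w"
      using dist_triangle[of "fst p" "snd p" x0] dist_triangle[of x0 "snd p" y0]
      by (simp add: u_def v_def w_def dist_commute)
    then have "(dist (fst p) (snd p))\<^sup>2 \<le> (u + v + w)\<^sup>2"
      by (rule power_mono) simp
    also have "\<dots> \<le> 3 * u\<^sup>2 + 3 * v\<^sup>2 + 3 * w\<^sup>2"
      using zero_le_power2[of "u - v"] zero_le_power2[of "v - w"] zero_le_power2[of "u - w"]
      by (simp add: power2_eq_square algebra_simps)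
    finally have "ennreal ((dist (fst p) (snd p))\<^sup>2) \<le> ennreal (3 * u\<^sup>2 + 3 * v\<^sup>2 + 3 * w\<^sup>2)"
      by (rule ennreal_leI)
    then show "ennreal ((dist (fst p) (snd p))\<^sup>2) \<le> 3 * ennreal ((dist x0 (fst p))\<^sup>2) +
        3 * ennreal ((dist x0 y0)\<^sup>2) + 3 * ennreal ((dist y0 (snd p))\<^sup>2)"
      by (simp add: u_def v_def w_def ennreal_plus ennreal_mult)
  qed
  also have "\<dots> = 3 * (\<integral>\<^sup>+ p. ennreal ((dist x0 (fst p))\<^sup>2) \<partial>\<pi>) + 3 * ennreal ((dist x0 y0)\<^sup>2)
      + 3 * (\<integral>\<^sup>+ p. ennreal ((dist y0 (snd p))\<^sup>2) \<partial>\<pi>)"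
    by (simp add: nn_integral_add nn_integral_cmult emeasure_space_1)
  also have "\<dots> < \<infinity>"
    using x1 y1 by (simp add: ennreal_mult_less_top)
  finally show ?thesis .
qed

text \<open>
For measures with finite second moment the product coupling has finite cost, so that \<^const>\<open>enn2real\<close> in the definition of
\<^const>\<open>W2\<close> loses nothing.
\<close>

lemma W2_squared:
  assumes \<mu>: "\<mu> \<in> P2" and \<nu>: "\<nu> \<in> P2"
  shows "ennreal ((W2 \<mu> \<nu>)\<^sup>2) = (INF \<pi>\<in>couplings \<mu> \<nu>. transport_cost \<pi>)"
proof -
  have c: "\<mu> \<Otimes>\<^sub>M \<nu> \<in> couplings \<mu> \<nu>"
    using assms by (intro product_in_couplings) (auto simp: P2_def)
  have "(INF \<pi>\<in>couplings \<mu> \<nu>. transport_cost \<pi>) \<le> transport_cost (\<mu> \<Otimes>\<^sub>M \<nu>)"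
    by (rule INF_lower[OF c])
  also have "\<dots> < \<infinity>" by (rule transport_cost_finite[OF c \<mu> \<nu>])
  finally show ?thesis by (simp add: W2_def)
qed

lemma near_optimal_coupling:
  assumes "\<mu> \<in> P2" "\<nu> \<in> P2" "e > 0"
  obtains \<pi> where "\<pi> \<in> couplings \<mu> \<nu>" "transport_cost \<pi> \<le> ennreal ((W2 \<mu> \<nu>)\<^sup>2 + e)"
proof -
  have "(INF \<pi>\<in>couplings \<mu> \<nu>. transport_cost \<pi>) < ennreal ((W2 \<mu> \<nu>)\<^sup>2 + e)"
    using assms by (simp flip: W2_squared add: ennreal_lessI)
  then show ?thesis using that by (auto simp: INF_less_iff intro: less_imp_le)
qed

text \<open>
A Wasserstein midpoint lives on metric midpoints. Take nearly optimal couplings of \<open>\<mu>0, \<mu>\<close> and of \<open>\<mu>, \<mu>1\<close> and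
glue them up to \<open>\<eta>\<close>. Let \<open>a\<close> and \<open>b\<close> be the lengths of the two steps and \<open>d \<le> D\<close> the distance of the end
points, so that \<open>d \<le> a + b + \<eta>\<close>. The identity
\<open>(a - b)\<^sup>2 + (a + b + \<eta>)\<^sup>2 = 2 a\<^sup>2 + 2 b\<^sup>2 + 2 \<eta> (a + b) + \<eta>\<^sup>2\<close>
has an expectation close to \<open>W\<^sup>2\<close> on the right, while the left side is at least \<open>d\<^sup>2\<close>, of expectation at least
\<open>W\<^sup>2\<close>, and exceeds it by \<open>\<delta>\<^sup>2\<close> where \<open>a \<ge> D / 2 + \<delta>\<close>: there either \<open>a - b \<ge> \<delta>\<close> or
\<open>a + b + \<eta> \<ge> D + \<delta>\<close>. As \<open>\<eta>\<close> tends to \<open>0\<close>, the probability of \<open>a \<ge> D / 2 + \<delta>\<close> is forced to be \<open>0\<close>.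

The conclusion has to be exact: a small exceptional mass far away could still carry a large part of the entropy
integral, since nothing is known yet about the volume of large sets.
\<close>

lemma W2_midpoint_concentration:
  fixes \<mu>0 \<mu> \<mu>1 :: "'a::polish_space measure"
  assumes P: "\<mu>0 \<in> P2" "\<mu> \<in> P2" "\<mu>1 \<in> P2"
    and W0: "W2 \<mu>0 \<mu> = W2 \<mu>0 \<mu>1 / 2" and W1: "W2 \<mu> \<mu>1 = W2 \<mu>0 \<mu>1 / 2"
    and A: "AE x in \<mu>0. x \<in> A" and B: "AE y in \<mu>1. y \<in> B"
    and D: "\<And>x y. x \<in> A \<Longrightarrow> y \<in> B \<Longrightarrow> dist x y \<le> D" and \<delta>: "\<delta> > 0"
  shows "AE z in \<mu>. \<exists>x\<in>A. dist x z < D / 2 + \<delta>"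
proof -
  define W where "W = W2 \<mu>0 \<mu>1"
  (* The open set in which the midpoints have to lie; p is the mass that is missed. *)
  define U where "U = (\<Union>x\<in>A. ball x (D / 2 + \<delta>))"
  have U: "open U" by (auto simp: U_def)
  have s: "sets \<mu> = sets borel" "prob_space \<mu>" using P by (auto simp: P2_def)
  interpret \<mu>: prob_space \<mu> by fact
  note sp = sets_eq_imp_space_eq[OF s(1), simplified]
  define p where "p = measure \<mu> (- U)"
  have cU[measurable]: "- U \<in> sets borel" using U by auto
  have key: "\<delta>\<^sup>2 * p \<le> \<eta> * (W\<^sup>2 + 13)" if \<eta>: "0 < \<eta>" "\<eta> \<le> 1" for \<eta>
  proof -
    obtain \<pi>1 where \<pi>1: "\<pi>1 \<in> couplings \<mu>0 \<mu>" "transport_cost \<pi>1 \<le> ennreal (W\<^sup>2 / 4 + \<eta>)"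
      using near_optimal_coupling[OF P(1,2) \<eta>(1)] unfolding W0 W_def[symmetric]
      by (auto simp: power_divide)
    obtain \<pi>2 where \<pi>2: "\<pi>2 \<in> couplings \<mu> \<mu>1" "transport_cost \<pi>2 \<le> ennreal (W\<^sup>2 / 4 + \<eta>)"
      using near_optimal_coupling[OF P(2,3) \<eta>(1)] unfolding W1 W_def[symmetric]
      by (auto simp: power_divide)
    obtain \<Gamma> :: "(('a \<times> 'a) \<times> ('a \<times> 'a)) measure"
      where \<Gamma>: "sets \<Gamma> = sets borel" "distr \<Gamma> borel fst = \<pi>1" "distr \<Gamma> borel snd = \<pi>2"
        "AE p in \<Gamma>. dist (snd (fst p)) (fst (snd p)) < \<eta>"
      using approximate_gluing[OF \<pi>1(1) \<pi>2(1) \<eta>(1)] by blast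
    note p1 = couplings_sets[OF \<pi>1(1)] and p2 = couplings_sets[OF \<pi>2(1)]
    note [measurable_cong] = \<Gamma>(1)
    have spG: "space \<Gamma> = UNIV" using sets_eq_imp_space_eq[OF \<Gamma>(1)] by simp
    have m1[measurable]: "fst \<in> measurable \<Gamma> borel" and m2[measurable]: "snd \<in> measurable \<Gamma> borel"
      by (simp_all cong: measurable_cong_sets)
    interpret G: prob_space \<Gamma>
      by (rule prob_space_distrD[OF m1]) (simp add: \<Gamma>(2) p1)
    have d1: "distr \<Gamma> borel (\<lambda>p. fst (fst p)) = \<mu>0"
      unfolding p1(4)[symmetric] \<Gamma>(2)[symmetric] by (subst distr_distr) (auto simp: comp_def)
    have d2: "distr \<Gamma> borel (\<lambda>p. snd (fst p)) = \<mu>"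
      unfolding p1(5)[symmetric] \<Gamma>(2)[symmetric] by (subst distr_distr) (auto simp: comp_def)
    have d3: "distr \<Gamma> borel (\<lambda>p. snd (snd p)) = \<mu>1"
      unfolding p2(5)[symmetric] \<Gamma>(3)[symmetric] by (subst distr_distr) (auto simp: comp_def)
    have [measurable]: "(\<lambda>p. (fst (fst p), snd (snd p))) \<in> measurable \<Gamma> borel"
      by (rule borel_measurable_Pair) auto
    define \<pi> where "\<pi> = distr \<Gamma> borel (\<lambda>p. (fst (fst p), snd (snd p)))"
    have \<pi>: "\<pi> \<in> couplings \<mu>0 \<mu>1"
      unfolding couplings_def \<pi>_def
      by (auto simp: distr_distr comp_def d1 d3 intro!: G.prob_space_distr)
    define a where "a p = dist (fst (fst p)) (snd (fst p))" for p :: "('a \<times> 'a) \<times> ('a \<times> 'a)"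
    define b where "b p = dist (fst (snd p)) (snd (snd p))" for p :: "('a \<times> 'a) \<times> ('a \<times> 'a)"
    define d where "d p = dist (fst (fst p)) (snd (snd p))" for p :: "('a \<times> 'a) \<times> ('a \<times> 'a)"
    have [measurable]: "a \<in> borel_measurable \<Gamma>" "b \<in> borel_measurable \<Gamma>" "d \<in> borel_measurable \<Gamma>"
      unfolding a_def b_def d_def by measurable
    have inta: "(\<integral>\<^sup>+ p. ennreal ((a p)\<^sup>2) \<partial>\<Gamma>) = transport_cost \<pi>1"
      unfolding transport_cost_def \<Gamma>(2)[symmetric] a_def by (subst nn_integral_distr) auto
    have intb: "(\<integral>\<^sup>+ p. ennreal ((b p)\<^sup>2) \<partial>\<Gamma>) = transport_cost \<pi>2"
      unfolding transport_cost_def \<Gamma>(3)[symmetric] b_def by (subst nn_integral_distr) auto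
    have intd: "(\<integral>\<^sup>+ p. ennreal ((d p)\<^sup>2) \<partial>\<Gamma>) = transport_cost \<pi>"
      unfolding transport_cost_def \<pi>_def d_def by (subst nn_integral_distr) auto
    have "ennreal (W\<^sup>2) \<le> transport_cost \<pi>"
      unfolding W_def W2_squared[OF P(1,3)] by (rule INF_lower[OF \<pi>])
    have AE1: "AE p in \<Gamma>. fst (fst p) \<in> A"
      using A unfolding d1[symmetric] by (rule AE_distrD[rotated]) measurable
    have AE3: "AE p in \<Gamma>. snd (snd p) \<in> B"
      using B unfolding d3[symmetric] by (rule AE_distrD[rotated]) measurable
    have pointwise: "AE p in \<Gamma>. ennreal ((d p)\<^sup>2) + ennreal (\<delta>\<^sup>2) * indicator (- U) (snd (fst p))
       \<le> ennreal (2 + 2 * \<eta>) * (ennreal ((a p)\<^sup>2) + ennreal ((b p)\<^sup>2)) + ennreal (4 * \<eta> + \<eta>\<^sup>2)"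
      using AE1 AE3 \<Gamma>(4)
    proof eventually_elim
      case (elim p)
      have ab: "a p \<ge> 0" "b p \<ge> 0" "d p \<ge> 0" by (auto simp: a_def b_def d_def)
      have dab: "d p \<le> a p + b p + \<eta>"
        using dist_triangle[of "fst (fst p)" "snd (snd p)" "snd (fst p)"]
          dist_triangle[of "snd (fst p)" "snd (snd p)" "fst (snd p)"] elim(3)
        by (simp add: a_def b_def d_def)
      have dD: "d p \<le> D" using D elim by (simp add: d_def)
      define i where "i = (indicator (- U) (snd (fst p)) :: real)"
      have *: "(d p)\<^sup>2 + \<delta>\<^sup>2 * i \<le> (a p - b p)\<^sup>2 + (a p + b p + \<eta>)\<^sup>2"
      proof (cases "snd (fst p) \<in> U")
        case True
        then have "i = 0" by (simp add: i_def)
        moreover have "(d p)\<^sup>2 \<le> (a p + b p + \<eta>)\<^sup>2"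
          using dab ab by (intro power_mono) auto
        ultimately show ?thesis by (simp add: add_increasing)
      next
        case False
        then have i: "i = 1" by (simp add: i_def)
        have aD: "a p \<ge> D / 2 + \<delta>"
          using False elim(1) by (force simp: U_def a_def)
        show ?thesis
        proof (cases "a p - b p \<ge> \<delta>")
          case True
          then have "\<delta>\<^sup>2 \<le> (a p - b p)\<^sup>2" using \<delta> by (intro power_mono) auto
          moreover have "(d p)\<^sup>2 \<le> (a p + b p + \<eta>)\<^sup>2"
            using dab ab by (intro power_mono) auto
          ultimately show ?thesis using i by simp
        next
          case False
          then have "d p + \<delta> \<le> a p + b p + \<eta>" using aD dD \<eta> by simp
          then have "(d p + \<delta>)\<^sup>2 \<le> (a p + b p + \<eta>)\<^sup>2"
            using ab \<delta> by (intro power_mono) auto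
          moreover have "(d p)\<^sup>2 + \<delta>\<^sup>2 \<le> (d p + \<delta>)\<^sup>2"
            using ab \<delta> by (simp add: power2_sum)
          ultimately show ?thesis using i by (simp add: add_increasing)
        qed
      qed
      have 2: "2 * a p \<le> 1 + (a p)\<^sup>2" "2 * b p \<le> 1 + (b p)\<^sup>2"
        using zero_le_power2[of "a p - 1"] zero_le_power2[of "b p - 1"]
        by (auto simp: power2_eq_square algebra_simps)
      have "(a p - b p)\<^sup>2 + (a p + b p + \<eta>)\<^sup>2
          = 2 * ((a p)\<^sup>2 + (b p)\<^sup>2) + \<eta> * (2 * a p + 2 * b p) + \<eta>\<^sup>2"
        by (simp add: power2_eq_square algebra_simps)
      also have "\<dots> \<le> 2 * ((a p)\<^sup>2 + (b p)\<^sup>2) + \<eta> * (2 * (a p)\<^sup>2 + 2 * (b p)\<^sup>2 + 4) + \<eta>\<^sup>2"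
        using 2 \<eta> zero_le_power2[of "a p"] zero_le_power2[of "b p"]
        by (intro add_right_mono add_left_mono mult_left_mono) linarith+
      also have "\<dots> = (2 + 2 * \<eta>) * ((a p)\<^sup>2 + (b p)\<^sup>2) + (4 * \<eta> + \<eta>\<^sup>2)"
        by (simp add: algebra_simps)
      finally have "ennreal ((d p)\<^sup>2 + \<delta>\<^sup>2 * i)
          \<le> ennreal ((2 + 2 * \<eta>) * ((a p)\<^sup>2 + (b p)\<^sup>2) + (4 * \<eta> + \<eta>\<^sup>2))"
        using * by (intro ennreal_leI) simp
      moreover have "ennreal i = indicator (- U) (snd (fst p))" "i \<ge> 0"
        by (auto simp: i_def split: split_indicator)
      ultimately show ?case
        using \<eta> by (simp add: ennreal_plus ennreal_mult del: ennreal_numeral ennreal_power)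
    qed
    have "ennreal (W\<^sup>2) + ennreal (\<delta>\<^sup>2) * emeasure \<mu> (- U)
        \<le> (\<integral>\<^sup>+ p. ennreal ((d p)\<^sup>2) \<partial>\<Gamma>) + ennreal (\<delta>\<^sup>2) * (\<integral>\<^sup>+ p. indicator (- U) (snd (fst p)) \<partial>\<Gamma>)"
    proof (intro add_mono mult_left_mono)
      show "ennreal (W\<^sup>2) \<le> (\<integral>\<^sup>+ p. ennreal ((d p)\<^sup>2) \<partial>\<Gamma>)"
        unfolding intd by fact
      have "emeasure \<mu> (- U) = (\<integral>\<^sup>+ z. indicator (- U) z \<partial>\<mu>)"
        using s by simp
      also have "\<dots> = (\<integral>\<^sup>+ p. indicator (- U) (snd (fst p)) \<partial>\<Gamma>)"
        unfolding d2[symmetric] by (subst nn_integral_distr) auto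
      finally show "emeasure \<mu> (- U) \<le> (\<integral>\<^sup>+ p. indicator (- U) (snd (fst p)) \<partial>\<Gamma>)" by simp
    qed simp
    also have "\<dots> = (\<integral>\<^sup>+ p. ennreal ((d p)\<^sup>2) + ennreal (\<delta>\<^sup>2) * indicator (- U) (snd (fst p)) \<partial>\<Gamma>)"
      by (simp add: nn_integral_add nn_integral_cmult)
    also have "\<dots> \<le> (\<integral>\<^sup>+ p. ennreal (2 + 2 * \<eta>) * (ennreal ((a p)\<^sup>2) + ennreal ((b p)\<^sup>2))
        + ennreal (4 * \<eta> + \<eta>\<^sup>2) \<partial>\<Gamma>)"
      by (rule nn_integral_mono_AE[OF pointwise])
    also have "\<dots> = ennreal (2 + 2 * \<eta>) * (transport_cost \<pi>1 + transport_cost \<pi>2) + ennreal (4 * \<eta> + \<eta>\<^sup>2)"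
      by (simp add: nn_integral_add nn_integral_cmult inta intb G.emeasure_space_1)
    also have "\<dots> \<le> ennreal (2 + 2 * \<eta>) * (ennreal (W\<^sup>2 / 4 + \<eta>) + ennreal (W\<^sup>2 / 4 + \<eta>)) + ennreal (4 * \<eta> + \<eta>\<^sup>2)"
      by (intro add_mono mult_left_mono \<pi>1 \<pi>2) auto
    also have "\<dots> = ennreal ((2 + 2 * \<eta>) * ((W\<^sup>2 / 4 + \<eta>) + (W\<^sup>2 / 4 + \<eta>)) + (4 * \<eta> + \<eta>\<^sup>2))"
      using \<eta> by (simp add: ennreal_plus[symmetric] ennreal_mult[symmetric] del: ennreal_plus)
    also have "ennreal (W\<^sup>2) + ennreal (\<delta>\<^sup>2) * emeasure \<mu> (- U) = ennreal (W\<^sup>2 + \<delta>\<^sup>2 * p)"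
      by (simp add: p_def \<mu>.emeasure_eq_measure ennreal_mult)
    finally have "W\<^sup>2 + \<delta>\<^sup>2 * p \<le> (2 + 2 * \<eta>) * ((W\<^sup>2 / 4 + \<eta>) + (W\<^sup>2 / 4 + \<eta>)) + (4 * \<eta> + \<eta>\<^sup>2)"
      using \<eta> by (subst (asm) ennreal_le_iff) auto
    also have "\<dots> = W\<^sup>2 + \<eta> * (W\<^sup>2 + 8) + 5 * \<eta>\<^sup>2"
      by (simp add: power2_eq_square algebra_simps)
    also have "\<eta>\<^sup>2 \<le> \<eta>" using \<eta> by (simp add: power2_eq_square mult_left_le_one_le)
    finally show ?thesis by (simp add: algebra_simps)
  qed
  have "\<delta>\<^sup>2 * p \<le> 0"
  proof (rule field_le_epsilon)
    fix e :: real assume e: "e > 0"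
    define C where "C = W\<^sup>2 + 13"
    have C: "C > 0" by (simp add: C_def add_nonneg_pos)
    have "\<delta>\<^sup>2 * p \<le> min 1 (e / C) * C"
      using key[of "min 1 (e / C)"] e C by (simp add: C_def)
    also have "\<dots> \<le> (e / C) * C" using C by (intro mult_right_mono) auto
    finally show "\<delta>\<^sup>2 * p \<le> 0 + e" using C by simp
  qed
  then have "p = 0"
    using \<delta> by (simp add: p_def mult_le_0_iff measure_le_0_iff)
  then show ?thesis
  proof (intro AE_I[of _ _ "- U"])
    show "- U \<in> sets \<mu>" using s cU by simp
  qed (auto simp: p_def \<mu>.emeasure_eq_measure U_def)
qed

section \<open>Densities and entropy\<close>

lemma metric_measure_space_sets:
  assumes "metric_measure_space M"
  shows "sets M = sets borel" "space M = UNIV"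
  using assms sets_eq_imp_space_eq[of M borel] by (auto simp: metric_measure_space_def)

lemma metric_measure_space_sigma_finite:
  assumes M: "metric_measure_space (M :: 'a::polish_space measure)"
  shows "sigma_finite_measure M"
proof -
  obtain r where r: "\<And>x. r x > 0" "\<And>x. emeasure M (ball x (r x)) < \<infinity>"
    using M unfolding metric_measure_space_def by metis
  obtain F where F: "F \<subseteq> range (\<lambda>x. ball x (r x))" "countable F" "\<Union>F = \<Union>(range (\<lambda>x. ball x (r x)))"
    using Lindelof[of "range (\<lambda>x. ball x (r x))"] by auto
  have "\<Union>F = UNIV"
    unfolding F(3) using r(1) by (auto intro!: bexI centre_in_ball[THEN iffD2])
  then show ?thesis
    using F r by (intro sigma_finite_measure.intro exI[of _ F]) (auto simp: metric_measure_space_sets[OF M] less_top)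
qed

text \<open>
The concave function \<open>x powr (1 - p)\<close> lies below its tangent at \<open>a\<close>. The proof uses convexity of \<open>exp\<close> at \<open>ln (x / a)\<close>
and \<open>0\<close>.
\<close>

lemma powr_tangent_bound:
  fixes x a p :: real
  assumes "x \<ge> 0" "a > 0" "0 < p" "p \<le> 1"
  shows "x powr (1 - p) \<le> (1 - p) * a powr (- p) * x + p * a powr (1 - p)"
proof (cases "x = 0")
  case True
  then show ?thesis using assms by auto
next
  case False
  then have x: "x > 0" using assms by simp
  have "x powr (1 - p) = exp ((1 - p) * ln (x / a) + p * 0) * a powr (1 - p)"
    using x assms by (simp add: powr_def ln_div flip: exp_add) (simp add: algebra_simps)
  also have "\<dots> \<le> ((1 - p) * exp (ln (x / a)) + p * exp 0) * a powr (1 - p)"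
    using assms convex_onD[OF exp_convex, of "1 - p" 0 "ln (x / a)"]
    by (intro mult_right_mono) (auto simp: add.commute)
  also have "\<dots> = (1 - p) * (x * (a powr (1 - p) / a)) + p * a powr (1 - p)"
    using x assms by (simp add: field_simps)
  also have "a powr (1 - p) / a = a powr (- p)"
    using assms by (simp add: powr_diff powr_minus_divide)
  finally show ?thesis by (simp add: mult_ac)
qed

text \<open>
The density chosen in the definition of \<^const>\<open>ac_density\<close> comes with a singular part. For an absolutely continuous measure
that part vanishes, since its carrier is a null set.
\<close>

lemma ac_density_properties:
  fixes M \<nu> :: "'a::polish_space measure"
  assumes M: "metric_measure_space M" and \<nu>: "\<nu> \<in> P2_ac M"
  shows "ac_density M \<nu> \<in> borel_measurable M" "\<And>x. 0 \<le> ac_density M \<nu> x"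
    "density M (\<lambda>x. ennreal (ac_density M \<nu> x)) = \<nu>"
proof -
  interpret sigma_finite_measure M by (rule metric_measure_space_sigma_finite[OF M])
  have ac: "absolutely_continuous M \<nu>" and s: "sets \<nu> = sets M" and p: "prob_space \<nu>"
    using \<nu> metric_measure_space_sets[OF M] by (auto simp: P2_ac_def P2_def)
  interpret \<nu>: prob_space \<nu> by fact
  define g where "g x = enn2real (RN_deriv M \<nu> x)" for x
  have [measurable]: "g \<in> borel_measurable M" unfolding g_def by measurable
  have "AE x in M. RN_deriv M \<nu> x \<noteq> \<infinity>"
    by (rule RN_deriv_finite[OF \<nu>.sigma_finite_measure_axioms ac s])
  then have "density M (\<lambda>x. ennreal (g x)) = density M (RN_deriv M \<nu>)"
    by (intro density_cong) (auto simp: g_def less_top elim!: eventually_mono)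
  also have "\<dots> = \<nu>" by (rule density_RN_deriv[OF ac s])
  finally have g: "density M (\<lambda>x. ennreal (g x)) = \<nu>" .
  have "lebesgue_decomposition M \<nu> g (null_measure M)"
    unfolding lebesgue_decomposition_def
  proof (intro conjI ballI)
    fix A assume "A \<in> sets M"
    then show "emeasure \<nu> A = set_nn_integral M A (\<lambda>x. ennreal (g x)) + emeasure (null_measure M) A"
      by (subst g[symmetric]) (simp add: emeasure_density g_def)
  qed (auto simp: g_def)
  then have "\<exists>\<rho> \<nu>s. lebesgue_decomposition M \<nu> \<rho> \<nu>s" by blast
  then have "\<exists>\<nu>s. lebesgue_decomposition M \<nu> (ac_density M \<nu>) \<nu>s"
    unfolding ac_density_def by (rule someI_ex)
  then obtain \<nu>s where L: "lebesgue_decomposition M \<nu> (ac_density M \<nu>) \<nu>s" by blast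
  then obtain Z where Z: "Z \<in> sets M" "emeasure M Z = 0" "emeasure \<nu>s (space M - Z) = 0"
    by (auto simp: lebesgue_decomposition_def)
  show m: "ac_density M \<nu> \<in> borel_measurable M" and "\<And>x. 0 \<le> ac_density M \<nu> x"
    using L by (auto simp: lebesgue_decomposition_def)
  have "emeasure \<nu> Z = 0"
    using ac Z by (auto simp: absolutely_continuous_def null_sets_def)
  then have "emeasure \<nu>s Z = 0"
    using L Z(1) by (auto simp: lebesgue_decomposition_def)
  then have zero: "emeasure \<nu>s A = 0" if "A \<in> sets M" for A
  proof -
    have ss: "sets \<nu>s = sets M" using L by (simp add: lebesgue_decomposition_def)
    have "emeasure \<nu>s A \<le> emeasure \<nu>s (Z \<union> (space M - Z))"
      using that Z ss sets.sets_into_space[OF that] by (intro emeasure_mono) auto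
    also have "\<dots> \<le> emeasure \<nu>s Z + emeasure \<nu>s (space M - Z)"
      using Z ss by (intro emeasure_subadditive) auto
    finally show ?thesis using \<open>emeasure \<nu>s Z = 0\<close> Z by simp
  qed
  show "density M (\<lambda>x. ennreal (ac_density M \<nu> x)) = \<nu>"
  proof (rule measure_eqI)
    fix A assume "A \<in> sets (density M (\<lambda>x. ennreal (ac_density M \<nu> x)))"
    then have A: "A \<in> sets M" by simp
    then show "emeasure (density M (\<lambda>x. ennreal (ac_density M \<nu> x))) A = emeasure \<nu> A"
      using L zero[OF A] m by (subst emeasure_density) (auto simp: lebesgue_decomposition_def)
  qed (simp add: s)
qed

text \<open>
Jensen's inequality on \<open>B\<close>, obtained by integrating the tangent line inequality at \<open>1 / b\<close>, the density of the
uniform distribution on \<open>B\<close>.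
\<close>

lemma entropy_integral_le:
  fixes M \<nu> :: "'a::polish_space measure"
  assumes M: "metric_measure_space M" and \<nu>: "\<nu> \<in> P2_ac M" and N: "1 \<le> N"
    and B: "B \<in> sets borel" "AE z in \<nu>. z \<in> B" and b: "emeasure M B = ennreal b" "b > 0"
  shows "(\<integral>\<^sup>+ x. ennreal (ac_density M \<nu> x powr (1 - 1 / N)) \<partial>M) \<le> ennreal (b powr (1 / N))"
proof -
  define \<rho> where "\<rho> = ac_density M \<nu>"
  note \<rho> = ac_density_properties[OF M \<nu>, folded \<rho>_def]
  note [measurable] = \<rho>(1)
  interpret \<nu>: prob_space \<nu> using \<nu> by (simp add: P2_ac_def P2_def)
  have [measurable]: "B \<in> sets M" using B metric_measure_space_sets[OF M] by simp
  define p where "p = 1 / N"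
  have p: "0 < p" "p \<le> 1" using N by (auto simp: p_def)
  define a where "a = 1 / b"
  have a: "a > 0" using b by (simp add: a_def)
  have "AE z in M. 0 < ennreal (\<rho> z) \<longrightarrow> z \<in> B"
    using B(2) unfolding \<rho>(3)[symmetric] by (subst (asm) AE_density) auto
  then have "AE z in M. ennreal (\<rho> z powr (1 - p)) \<le>
      ennreal ((1 - p) * a powr (- p)) * ennreal (\<rho> z) + ennreal (p * a powr (1 - p)) * indicator B z"
  proof eventually_elim
    case (elim z)
    show ?case
    proof (cases "z \<in> B")
      case True
      have "ennreal (\<rho> z powr (1 - p)) \<le> ennreal ((1 - p) * a powr (- p) * \<rho> z + p * a powr (1 - p))"
        by (intro ennreal_leI powr_tangent_bound \<rho> a p)
      then show ?thesis using True p \<rho>(2) by (simp add: ennreal_plus ennreal_mult)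
    next
      case False
      then have "\<rho> z = 0" using elim \<rho>(2)[of z] by (auto simp: ennreal_less_zero_iff)
      then show ?thesis by simp
    qed
  qed
  then have "(\<integral>\<^sup>+ z. ennreal (\<rho> z powr (1 - p)) \<partial>M) \<le> (\<integral>\<^sup>+ z. ennreal ((1 - p) * a powr (- p)) * ennreal (\<rho> z) + ennreal (p * a powr (1 - p)) * indicator B z \<partial>M)"
    by (rule nn_integral_mono_AE)
  also have "\<dots> = ennreal ((1 - p) * a powr (- p)) * (\<integral>\<^sup>+ z. ennreal (\<rho> z) \<partial>M) + ennreal (p * a powr (1 - p)) * emeasure M B"
    by (simp add: nn_integral_add nn_integral_cmult)
  also have "(\<integral>\<^sup>+ z. ennreal (\<rho> z) \<partial>M) = emeasure \<nu> (space \<nu>)"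
  proof -
    have "emeasure \<nu> (space \<nu>) = emeasure (density M (\<lambda>x. ennreal (\<rho> x))) (space M)"
      by (metis \<rho>(3) space_density)
    also have "\<dots> = (\<integral>\<^sup>+ z. ennreal (\<rho> z) \<partial>M)"
      by (subst emeasure_density) (auto intro!: nn_integral_cong)
    finally show ?thesis by simp
  qed
  also have "\<dots> = 1" by (rule \<nu>.emeasure_space_1)
  also have "ennreal ((1 - p) * a powr (- p)) * 1 + ennreal (p * a powr (1 - p)) * emeasure M B
      = ennreal ((1 - p) * a powr (- p) + p * a powr (1 - p) * b)"
    using p b by (simp add: ennreal_plus ennreal_mult)
  also have "a powr (1 - p) * b = a powr (- p)"
    using b by (simp add: a_def powr_diff powr_minus_divide powr_divide)
  then have "(1 - p) * a powr (- p) + p * a powr (1 - p) * b = a powr (- p)"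
    by (simp add: algebra_simps)
  also have "a powr (- p) = b powr p"
    using b by (simp add: a_def powr_divide powr_minus_divide)
  finally show ?thesis by (simp add: \<rho>_def p_def)
qed

definition uniform_density :: "'a measure \<Rightarrow> 'a set \<Rightarrow> 'a \<Rightarrow> real" where
  "uniform_density M A x = indicator A x / measure M A"

lemma uniform_density_measure:
  fixes M :: "'a::polish_space measure"
  assumes M: "metric_measure_space M" and A: "A \<in> sets borel" "A \<subseteq> ball x R"
    and pos: "0 < emeasure M A" "emeasure M A < \<infinity>"
  defines "\<mu> \<equiv> density M (\<lambda>x. ennreal (uniform_density M A x))"
  shows "uniform_density M A \<in> borel_measurable M" "\<And>x. 0 \<le> uniform_density M A x"
    "\<mu> \<in> P2_ac M" "bounded (measure_support \<mu>)" "AE x in \<mu>. x \<in> A"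
    "\<And>N x. x \<in> A \<Longrightarrow> uniform_density M A x powr (- 1 / N) = measure M A powr (1 / N)"
proof -
  note s = metric_measure_space_sets[OF M]
  have [measurable]: "A \<in> sets M" using A s by simp
  have mA: "emeasure M A = ennreal (measure M A)" 
    using pos by (intro emeasure_eq_ennreal_measure) auto
  have mpos: "measure M A > 0"
    using pos mA by (simp add: ennreal_less_zero_iff)
  show meas[measurable]: "uniform_density M A \<in> borel_measurable M"
    unfolding uniform_density_def[abs_def] by measurable
  show nn: "0 \<le> uniform_density M A x" for x by (simp add: uniform_density_def)
  have em: "emeasure \<mu> B = emeasure M (A \<inter> B) / emeasure M A" if "B \<in> sets M" for B
  proof -
    have "emeasure \<mu> B = (\<integral>\<^sup>+ x. ennreal (1 / measure M A) * indicator (A \<inter> B) x \<partial>M)"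
      unfolding \<mu>_def using that
      by (subst emeasure_density) (auto simp: uniform_density_def split: split_indicator intro!: nn_integral_cong)
    also have "\<dots> = ennreal (1 / measure M A) * emeasure M (A \<inter> B)"
      using that by (subst nn_integral_cmult_indicator) auto
    also have "ennreal (1 / measure M A) = 1 / emeasure M A"
      using mpos mA by (simp add: divide_ennreal flip: ennreal_1)
    finally show ?thesis by (simp add: divide_ennreal_def mult.commute)
  qed
  have "emeasure \<mu> (space \<mu>) = 1"
    using pos by (subst em) (auto simp: \<mu>_def s ennreal_divide_self)
  then interpret \<mu>: prob_space \<mu> by (rule prob_spaceI)
  show AE: "AE x in \<mu>. x \<in> A"
    unfolding \<mu>_def by (subst AE_density) (auto simp: uniform_density_def split: split_indicator)
  have "(\<integral>\<^sup>+ y. ennreal ((dist x y)\<^sup>2) \<partial>\<mu>) \<le> (\<integral>\<^sup>+ y. ennreal (R\<^sup>2) \<partial>\<mu>)"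
    using AE A(2) by (intro nn_integral_mono_AE)
      (auto elim!: eventually_mono intro!: ennreal_leI power_mono simp: subset_eq less_imp_le)
  also have "\<dots> < \<infinity>" by (simp add: \<mu>.emeasure_space_1)
  finally have "\<mu> \<in> P2"
    using \<mu>.prob_space_axioms s by (auto simp: P2_def \<mu>_def)
  moreover have "absolutely_continuous M \<mu>"
    unfolding \<mu>_def by (rule absolutely_continuousI_density) measurable
  ultimately show "\<mu> \<in> P2_ac M" by (simp add: P2_ac_def)
  have "measure_support \<mu> \<subseteq> cball x R"
  proof (rule subsetI, rule ccontr)
    fix y assume y: "y \<in> measure_support \<mu>" "y \<notin> cball x R"
    then have d: "dist x y - R > 0" by simp
    have "A \<inter> ball y (dist x y - R) = {}"
    proof (rule ccontr)
      assume "A \<inter> ball y (dist x y - R) \<noteq> {}"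
      then obtain z where z: "z \<in> A" "dist y z < dist x y - R" by auto
      then have "dist x z < R" using A(2) by auto
      then show False using z dist_triangle[of x y z] by (simp add: dist_commute)
    qed
    then have "emeasure \<mu> (ball y (dist x y - R)) = 0"
      using s by (subst em) (auto simp: )
    moreover have "0 < emeasure \<mu> (ball y (dist x y - R))"
      using y(1) d unfolding measure_support_def by blast
    ultimately show False by simp
  qed
  then show "bounded (measure_support \<mu>)" using bounded_cball bounded_subset by blast
  fix N x assume "x \<in> A"
  then show "uniform_density M A x powr (- 1 / N) = measure M A powr (1 / N)"
    using mpos by (simp add: uniform_density_def powr_divide powr_minus_divide)
qed

text \<open>
Evaluation at a time is 1-Lipschitz on bounded continuous functions, hence measurable, so almost sure properties of the marginals
pass to the end points of almost every geodesic.
\<close>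

lemma dynamical_coupling_AE:
  fixes \<Xi> :: "(real \<Rightarrow>\<^sub>C 'a::polish_space) measure"
  assumes D: "dynamical_optimal_coupling \<mu> \<nu> \<Xi>"
    and A: "AE x in \<mu>. x \<in> A" and B: "AE y in \<nu>. y \<in> B"
  shows "AE \<gamma> in \<Xi>. \<gamma> \<in> geodesics \<and> apply_bcontfun \<gamma> 0 \<in> A \<and> apply_bcontfun \<gamma> 1 \<in> B"
proof -
  define e where "e \<gamma> = (apply_bcontfun \<gamma> (0::real), apply_bcontfun \<gamma> (1::real))" for \<gamma> :: "real \<Rightarrow>\<^sub>C 'a"
  have s: "sets \<Xi> = sets (restrict_space borel geodesics)"
    using D by (simp add: dynamical_optimal_coupling_def)
  have sp: "space \<Xi> = geodesics"
    using sets_eq_imp_space_eq[OF s] by (simp add: space_restrict_space)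
  have ev: "continuous_on UNIV (\<lambda>\<gamma> :: real \<Rightarrow>\<^sub>C 'a. apply_bcontfun \<gamma> t)" for t :: real
  proof -
    have "1-lipschitz_on UNIV (\<lambda>\<gamma> :: real \<Rightarrow>\<^sub>C 'a. apply_bcontfun \<gamma> t)"
      by (rule lipschitz_onI) (auto intro: dist_bounded)
    then show ?thesis by (rule lipschitz_on_continuous_on)
  qed
  have "e \<in> borel_measurable borel"
    unfolding e_def by (intro borel_measurable_continuous_onI continuous_on_Pair ev)
  then have e: "e \<in> borel_measurable \<Xi>"
    by (subst measurable_cong_sets[OF s refl]) (rule measurable_restrict_space1)
  have c: "distr \<Xi> borel e \<in> couplings \<mu> \<nu>"
    using D by (auto simp: dynamical_optimal_coupling_def optimal_coupling_def e_def[abs_def])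
  have "AE p in distr \<Xi> borel e. fst p \<in> A"
    using A unfolding couplings_sets(4)[OF c, symmetric] by (rule AE_distrD[rotated]) simp
  then have 1: "AE \<gamma> in \<Xi>. fst (e \<gamma>) \<in> A" by (rule AE_distrD[OF e])
  have "AE p in distr \<Xi> borel e. snd p \<in> B"
    using B unfolding couplings_sets(5)[OF c, symmetric] by (rule AE_distrD[rotated]) simp
  then have 2: "AE \<gamma> in \<Xi>. snd (e \<gamma>) \<in> B" by (rule AE_distrD[OF e])
  show ?thesis
    using 1 2 AE_space by eventually_elim (simp add: e_def sp)
qed

section \<open>The doubling property under a lower curvature bound\<close>

text \<open>
A Brunn-Minkowski inequality: transport the uniform distribution on \<open>A\<close> to the one on \<open>B\<close>. The midpoint measure
is carried by \<open>U\<close>, so Jensen bounds its entropy integral by the right-hand side, and the curvature-dimension inequality at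
time \<open>1/2\<close> bounds it from below by the left-hand side. Since \<open>A\<close> and \<open>B\<close> are disjoint, no transport ray
is trivial and the bound on the distortion coefficients applies. In the curvature-dimension condition the midpoint measure is not tied to
the dynamical coupling; its carrier is therefore controlled only through its Wasserstein distances.
\<close>

lemma midpoint_brunn_minkowski:
  fixes M :: "'a::polish_space measure"
  assumes M: "metric_measure_space M" and N: "1 \<le> N" and CD: "CD M k N"
    and A: "A \<in> sets borel" "A \<subseteq> ball x R" "0 < emeasure M A" "emeasure M A < \<infinity>"
    and B: "B \<in> sets borel" "B \<subseteq> ball x R" "0 < emeasure M B" "emeasure M B < \<infinity>"
    and disj: "A \<inter> B = {}"
    and D: "\<And>x y. x \<in> A \<Longrightarrow> y \<in> B \<Longrightarrow> dist x y \<le> D"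
    and L: "\<And>x y. x \<in> A \<Longrightarrow> y \<in> B \<Longrightarrow> dist x y \<le> L"
    and K: "K \<le> 0"
      "\<And>\<gamma> t. \<gamma> \<in> geodesics \<Longrightarrow> apply_bcontfun \<gamma> 0 \<in> A \<Longrightarrow> apply_bcontfun \<gamma> 1 \<in> B \<Longrightarrow> t \<in> {0..1} \<Longrightarrow>
         K \<le> k (apply_bcontfun \<gamma> t)"
    and U: "U \<in> sets borel" "0 < emeasure M U" "emeasure M U < \<infinity>" 
    and \<delta>: "0 < \<delta>" "\<And>x z. x \<in> A \<Longrightarrow> dist x z < D / 2 + \<delta> \<Longrightarrow> z \<in> U"
  shows "1/2 * cosh (sqrt (- (K / (N - 1))) * L) powr (- ((N - 1) / N)) *
           (measure M A powr (1 / N) + measure M B powr (1 / N)) \<le> measure M U powr (1 / N)"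
proof -
  define \<rho>0 where "\<rho>0 = uniform_density M A"
  define \<rho>1 where "\<rho>1 = uniform_density M B"
  define \<mu>0 where "\<mu>0 = density M (\<lambda>x. ennreal (\<rho>0 x))"
  define \<mu>1 where "\<mu>1 = density M (\<lambda>x. ennreal (\<rho>1 x))"
  note u0 = uniform_density_measure[OF M A, folded \<rho>0_def, folded \<mu>0_def]
  note u1 = uniform_density_measure[OF M B, folded \<rho>1_def, folded \<mu>1_def]
  obtain \<Xi> \<nu> where \<Xi>: "dynamical_optimal_coupling \<mu>0 \<mu>1 \<Xi>"
    and \<nu>: "\<And>t. t \<in> {0..1} \<Longrightarrow> \<nu> t \<in> P2_ac M" "geodesic_wrt W2 \<nu>" "\<nu> 0 = \<mu>0" "\<nu> 1 = \<mu>1"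
    and S: "\<And>t N'. t \<in> {0..1} \<Longrightarrow> N \<le> N' \<Longrightarrow> S_entropy N' M (\<nu> t) \<le>
              - enn2ereal (\<integral>\<^sup>+ \<gamma>.
                  tau N' (1 - t) (k_minus k \<gamma>) (speed \<gamma>) *
                    ennreal (\<rho>0 (apply_bcontfun \<gamma> 0) powr (- 1 / N')) +
                  tau N' t (k_plus k \<gamma>) (speed \<gamma>) *
                    ennreal (\<rho>1 (apply_bcontfun \<gamma> 1) powr (- 1 / N')) \<partial>\<Xi>)"
    using CD[unfolded CD_def, rule_format, OF u0(1,2) u1(1,2), folded \<mu>0_def \<mu>1_def, OF u0(3,4) u1(3,4)]
    by blast
  interpret \<Xi>: prob_space \<Xi> using \<Xi> by (simp add: dynamical_optimal_coupling_def)
  define c where "c = 1/2 * cosh (sqrt (- (K / (N - 1))) * L) powr (- ((N - 1) / N))"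
  have c: "c \<ge> 0" by (simp add: c_def)
  have half: "(1/2 :: real) \<in> {0..1}" by simp
  have "AE z in \<nu> (1/2). \<exists>x\<in>A. dist x z < D / 2 + \<delta>"
  proof (rule W2_midpoint_concentration[where B = B])
    show "\<mu>0 \<in> P2" "\<nu> (1/2) \<in> P2" "\<mu>1 \<in> P2"
      using u0(3) u1(3) \<nu>(1)[OF half] by (auto simp: P2_ac_def)
    show "W2 \<mu>0 (\<nu> (1/2)) = W2 \<mu>0 \<mu>1 / 2" "W2 (\<nu> (1/2)) \<mu>1 = W2 \<mu>0 \<mu>1 / 2"
      using \<nu>(2)[unfolded geodesic_wrt_def, rule_format, of 0 "1/2"]
        \<nu>(2)[unfolded geodesic_wrt_def, rule_format, of "1/2" 1] \<nu>(3,4) by auto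
  qed (use u0(5) u1(5) D \<delta> in auto)
  then have "AE z in \<nu> (1/2). z \<in> U"
    by eventually_elim (use \<delta> in blast)
  moreover have MU: "emeasure M U = ennreal (measure M U)"
    using U by (intro emeasure_eq_ennreal_measure) auto
  moreover have "0 < measure M U"
    using U(2) unfolding MU by (simp add: ennreal_less_zero_iff)
  ultimately have J: "(\<integral>\<^sup>+ x. ennreal (ac_density M (\<nu> (1/2)) x powr (1 - 1 / N)) \<partial>M)
      \<le> ennreal (measure M U powr (1 / N))"
    using entropy_integral_le[OF M \<nu>(1)[OF half] N U(1)] by simp
  have "AE \<gamma> in \<Xi>. ennreal (c * (measure M A powr (1 / N) + measure M B powr (1 / N))) \<le>
       tau N (1 - 1/2) (k_minus k \<gamma>) (speed \<gamma>) * ennreal (\<rho>0 (apply_bcontfun \<gamma> 0) powr (- 1 / N)) +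
       tau N (1/2) (k_plus k \<gamma>) (speed \<gamma>) * ennreal (\<rho>1 (apply_bcontfun \<gamma> 1) powr (- 1 / N))"
    using dynamical_coupling_AE[OF \<Xi> u0(5) u1(5)]
  proof eventually_elim
    case (elim \<gamma>)
    define \<theta> where "\<theta> = speed \<gamma>"
    have \<theta>: "0 < \<theta>" "\<theta> \<le> L"
      using elim disj L by (auto simp: \<theta>_def speed_def)
    have plus: "K \<le> k_plus k \<gamma> s" if "s \<in> {0..\<theta>}" for s
      unfolding k_plus_def unit_speed_def \<theta>_def[symmetric]
      using elim that \<theta> by (intro K) auto
    have minus: "K \<le> k_minus k \<gamma> s" if "s \<in> {0..\<theta>}" for s
      unfolding k_minus_def \<theta>_def[symmetric] using that by (intro plus) auto
    have e0: "\<rho>0 (apply_bcontfun \<gamma> 0) powr (- 1 / N) = measure M A powr (1 / N)"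
      and e1: "\<rho>1 (apply_bcontfun \<gamma> 1) powr (- 1 / N) = measure M B powr (1 / N)"
      using elim u0(6) u1(6) by blast+
    have "ennreal c * ennreal (measure M A powr (1 / N)) + ennreal c * ennreal (measure M B powr (1 / N)) \<le>
       tau N (1/2) (k_minus k \<gamma>) \<theta> * ennreal (\<rho>0 (apply_bcontfun \<gamma> 0) powr (- 1 / N)) +
       tau N (1/2) (k_plus k \<gamma>) \<theta> * ennreal (\<rho>1 (apply_bcontfun \<gamma> 1) powr (- 1 / N))"
      unfolding c_def e0 e1 by (intro add_mono mult_right_mono tau_half_lower \<theta> N K plus minus) auto
    then show ?case
      using c by (simp add: \<theta>_def distrib_left ennreal_plus ennreal_mult)
  qed
  from nn_integral_mono_AE[OF this]
  have "ennreal (c * (measure M A powr (1 / N) + measure M B powr (1 / N))) \<le> (\<integral>\<^sup>+ \<gamma>.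
       tau N (1 - 1/2) (k_minus k \<gamma>) (speed \<gamma>) * ennreal (\<rho>0 (apply_bcontfun \<gamma> 0) powr (- 1 / N)) +
       tau N (1/2) (k_plus k \<gamma>) (speed \<gamma>) * ennreal (\<rho>1 (apply_bcontfun \<gamma> 1) powr (- 1 / N)) \<partial>\<Xi>)"
    by (simp add: \<Xi>.emeasure_space_1)
  also have "\<dots> \<le> (\<integral>\<^sup>+ x. ennreal (ac_density M (\<nu> (1/2)) x powr (1 - 1 / N)) \<partial>M)"
    using S[OF half order_refl] by (simp add: S_entropy_def less_eq_ennreal.rep_eq)
  also note J
  finally show ?thesis by (simp add: c_def)
qed

lemma powr_add_le_add_powr:
  fixes a b p :: real
  assumes "0 \<le> a" "0 \<le> b" "0 < p" "p \<le> 1"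
  shows "(a + b) powr p \<le> a powr p + b powr p"
proof (cases "a + b = 0")
  case True
  then show ?thesis using assms by simp
next
  case False
  then have ab: "a + b > 0" using assms by linarith
  have *: "x \<le> x powr p" if "0 \<le> x" "x \<le> 1" for x :: real
    using powr_mono'[of p 1 x] that assms by (cases "x = 0") auto
  have "1 = a / (a + b) + b / (a + b)" using ab by (simp add: add_divide_distrib[symmetric])
  also have "\<dots> \<le> (a / (a + b)) powr p + (b / (a + b)) powr p"
    using assms ab by (intro add_mono *) auto
  also have "\<dots> = (a powr p + b powr p) / (a + b) powr p"
    using assms ab by (simp add: powr_divide add_divide_distrib)
  finally show ?thesis using ab by (simp add: field_simps)
qed

lemma geodesic_stays_in_ball:
  assumes \<gamma>: "\<gamma> \<in> geodesics" "t \<in> {0..1}" and a: "dist x (apply_bcontfun \<gamma> 0) < \<epsilon>"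
    and b: "dist x (apply_bcontfun \<gamma> 1) < s"
  shows "dist x (apply_bcontfun \<gamma> t) < s + 2 * \<epsilon>"
proof -
  have "dist (apply_bcontfun \<gamma> 0) (apply_bcontfun \<gamma> t) = t * dist (apply_bcontfun \<gamma> 0) (apply_bcontfun \<gamma> 1)"
  proof -
    have "geodesic_wrt dist (apply_bcontfun \<gamma>)" using \<gamma>(1) by (simp add: geodesics_def)
    from this[unfolded geodesic_wrt_def, rule_format, of 0 t] \<gamma>(2) show ?thesis by simp
  qed
  also have "\<dots> \<le> dist (apply_bcontfun \<gamma> 0) (apply_bcontfun \<gamma> 1)"
    using \<gamma>(2) by (simp add: mult_left_le_one_le)
  finally show ?thesis
    using a b dist_triangle[of "apply_bcontfun \<gamma> 0" "apply_bcontfun \<gamma> 1" x]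
      dist_triangle[of x "apply_bcontfun \<gamma> t" "apply_bcontfun \<gamma> 0"]
    by (simp add: dist_commute)
qed

lemma doubling_from_root_inequality:
  fixes C N :: real
  assumes "1 \<le> N" "C > 0" "0 \<le> m" "0 \<le> m'"
    and le: "1/2 * C powr (- ((N - 1) / N)) * m powr (1 / N) \<le> m' powr (1 / N)"
  shows "m \<le> 2 powr N * C powr (N - 1) * m'"
proof -
  have "(1/2 * C powr (- ((N - 1) / N)) * m powr (1 / N)) powr N \<le> (m' powr (1 / N)) powr N"
    using assms by (intro powr_mono2 le) auto
  then have "C powr (1 - N) * m / 2 powr N \<le> m'"
    using assms by (simp add: powr_mult powr_divide powr_powr)
  moreover have "C powr (1 - N) = 1 / C powr (N - 1)"
    by (simp flip: powr_minus_divide)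
  ultimately show ?thesis
    using assms by (simp add: field_simps)
qed

text \<open>
Apply the midpoint inequality to \<open>A = ball x \<epsilon>\<close> and to subsets \<open>B\<close> of finite measure of the remaining part of
\<open>ball x (2 * r - 4 * \<epsilon>)\<close>. The margin \<open>4 * \<epsilon>\<close> keeps midpoints inside \<open>ball x r\<close> and geodesics from \<open>A\<close> to \<open>B\<close> inside
\<open>ball x (2 * r)\<close>, where the curvature bound holds. Both terms of the inequality are kept: \<open>(a + b) powr (1/N) \<le> a powr (1/N) + b powr (1/N)\<close> then
yields the measure of the whole ball. This is how \<open>A\<close> and \<open>B\<close> can be disjoint although \<open>x\<close> may be an atom. The sets \<open>B\<close>
exhaust the remaining part, whose measure is not known to be finite at this stage.
\<close>

lemma doubling_smaller_balls:
  fixes M :: "'a::polish_space measure"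
  assumes M: "metric_measure_space M" and supp: "measure_support M = UNIV"
    and N: "1 \<le> N" and CD: "CD M k N" and X': "bounded X'" "ball x (2 * r) \<subseteq> X'"
    and K: "K \<le> 0" "\<And>z. z \<in> X' \<Longrightarrow> K \<le> k z" and fin: "emeasure M (ball x r) < \<infinity>"
    and \<epsilon>: "0 < \<epsilon>" "4 * \<epsilon> < r" and r: "0 < r" 
  shows "emeasure M (ball x (2 * r - 4 * \<epsilon>)) \<le>
    ennreal (2 powr N * cosh (sqrt (- (K / (N - 1))) * diameter X') powr (N - 1)) * emeasure M (ball x r)"
proof -
  note s = metric_measure_space_sets[OF M]
  have pos: "0 < emeasure M (ball y e)" if "e > 0" for y e
    using supp that by (auto simp: measure_support_def)
  interpret sigma_finite_measure M by (rule metric_measure_space_sigma_finite[OF M])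
  define h where "h = cosh (sqrt (- (K / (N - 1))) * diameter X')"
  have h: "h \<ge> 1" unfolding h_def by (rule cosh_real_ge_1)
  define A where "A = ball x \<epsilon>"
  define S where "S = ball x (2 * r - 4 * \<epsilon>) - ball x \<epsilon>"
  have Ar: "A \<subseteq> ball x r" using \<epsilon> by (auto simp: A_def)
  have Afin: "emeasure M A < \<infinity>"
    by (rule order.strict_trans1[OF emeasure_mono[OF Ar] fin]) (simp add: s)
  have main: "emeasure M A + emeasure M B \<le> ennreal (2 powr N * h powr (N - 1)) * emeasure M (ball x r)"
    if B: "B \<in> sets M" "B \<subseteq> S" "emeasure M B < \<infinity>" for B
  proof (cases "emeasure M B = 0")
    case True
    have "emeasure M A + emeasure M B \<le> 1 * emeasure M (ball x r)"
      using emeasure_mono[OF Ar, of M] s True by simp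
    also have "\<dots> \<le> ennreal (2 powr N * h powr (N - 1)) * emeasure M (ball x r)"
    proof (rule mult_right_mono)
      have "1 * 1 \<le> 2 powr N * h powr (N - 1)"
        using N h by (intro mult_mono) (auto simp: ge_one_powr_ge_zero)
      then show "1 \<le> ennreal (2 powr N * h powr (N - 1))" 
        using ennreal_leI by fastforce
    qed simp
    finally show ?thesis .
  next
    case False
    have Bs: "dist x y < 2 * r - 4 * \<epsilon>" "\<not> dist x y < \<epsilon>" if "y \<in> B" for y
      using B(2) that by (auto simp: S_def)
    have AB: "dist z y \<le> 2 * r - 3 * \<epsilon>" if "z \<in> A" "y \<in> B" for z y
      using Bs[OF that(2)] that(1) dist_triangle[of z y x] by (simp add: A_def dist_commute)
    have AX: "A \<subseteq> X'" using X'(2) \<epsilon> by (auto simp: A_def)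
    have BX: "B \<subseteq> X'" using X'(2) Bs \<epsilon> by fastforce
    have "1/2 * cosh (sqrt (- (K / (N - 1))) * diameter X') powr (- ((N - 1) / N)) *
           (measure M A powr (1 / N) + measure M B powr (1 / N)) \<le> measure M (ball x r) powr (1 / N)"
    proof (rule midpoint_brunn_minkowski[OF M N CD, where x = x and R = "2 * r" and D = "2 * r - 3 * \<epsilon>" and \<delta> = "\<epsilon> / 2"])
      show "A \<in> sets borel" "B \<in> sets borel" "ball x r \<in> sets borel" using B s by (auto simp: A_def)
      show "A \<subseteq> ball x (2 * r)" using Ar r by auto
      show "B \<subseteq> ball x (2 * r)" using Bs \<epsilon> by fastforce
      show "0 < emeasure M A" using pos \<epsilon> by (simp add: A_def)
      show "0 < emeasure M (ball x r)" using pos r by simp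
      show "0 < emeasure M B" using False by (simp add: zero_less_iff_neq_zero)
      show "A \<inter> B = {}" using Bs by (force simp: A_def)
      show "dist z y \<le> diameter X'" if "z \<in> A" "y \<in> B" for z y
        using AX BX X'(1) that by (intro diameter_bounded_bound) auto
      show "K \<le> k (apply_bcontfun \<gamma> t)" if "\<gamma> \<in> geodesics" "apply_bcontfun \<gamma> 0 \<in> A"
          "apply_bcontfun \<gamma> 1 \<in> B" "t \<in> {0..1}" for \<gamma> t
      proof -
        have "dist x (apply_bcontfun \<gamma> t) < (2 * r - 4 * \<epsilon>) + 2 * \<epsilon>"
          using that Bs by (intro geodesic_stays_in_ball) (auto simp: A_def)
        then show ?thesis using X'(2) \<epsilon> by (intro K) auto
      qed
      show "z \<in> ball x r" if "y \<in> A" "dist y z < (2 * r - 3 * \<epsilon>) / 2 + \<epsilon> / 2" for y z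
      proof -
        have "dist x y < \<epsilon>" using that(1) by (simp add: A_def)
        moreover have "(2 * r - 3 * \<epsilon>) / 2 + \<epsilon> / 2 = r - \<epsilon>" by (simp add: field_simps)
        ultimately have "dist x z < r" using that(2) dist_triangle[of x z y] by linarith
        then show ?thesis by simp
      qed
      show "emeasure M A < \<infinity>" "emeasure M B < \<infinity>" "emeasure M (ball x r) < \<infinity>"
        by (fact Afin B(3) fin)+
      show "0 < \<epsilon> / 2" using \<epsilon> by simp
    qed (fact AB K(1))+
    then have "1/2 * h powr (- ((N - 1) / N)) *
           (measure M A powr (1 / N) + measure M B powr (1 / N)) \<le> measure M (ball x r) powr (1 / N)"
      by (simp add: h_def)
    moreover have "1/2 * h powr (- ((N - 1) / N)) * (measure M A + measure M B) powr (1 / N) \<le> 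
        1/2 * h powr (- ((N - 1) / N)) * (measure M A powr (1 / N) + measure M B powr (1 / N))"
      using N by (intro mult_left_mono powr_add_le_add_powr) auto
    ultimately have "1/2 * h powr (- ((N - 1) / N)) * (measure M A + measure M B) powr (1 / N)
        \<le> measure M (ball x r) powr (1 / N)"
      by (rule order_trans[rotated])
    then have "measure M A + measure M B \<le> 2 powr N * h powr (N - 1) * measure M (ball x r)"
      using N h by (intro doubling_from_root_inequality) auto
    then have "ennreal (measure M A + measure M B) \<le> ennreal (2 powr N * h powr (N - 1) * measure M (ball x r))"
      by (rule ennreal_leI)
    then show ?thesis
      using Afin B fin by (simp add: ennreal_plus ennreal_mult emeasure_eq_ennreal_measure)
  qed
  obtain F where F: "range F \<subseteq> sets M" "(\<Union>i. F i) = space M" "\<And>i. emeasure M (F i) \<noteq> \<infinity>" "incseq F"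
    using sigma_finite_incseq by metis
  have Fm: "F i \<in> sets M" for i using F(1) by auto
  have SM: "S \<in> sets M" using s by (auto simp: S_def)
  have "emeasure M (ball x (2 * r - 4 * \<epsilon>)) = emeasure M A + emeasure M S"
    using s \<epsilon> by (subst plus_emeasure) (auto simp: A_def S_def intro!: arg_cong[of _ _ "emeasure M"])
  also have "emeasure M S = (SUP i. emeasure M (S \<inter> F i))"
    using F(2,4) Fm SM s by (subst SUP_emeasure_incseq)
      (auto simp: incseq_def intro!: arg_cong[of _ _ "emeasure M"])
  also have "emeasure M A + (SUP i. emeasure M (S \<inter> F i)) = (SUP i. emeasure M A + emeasure M (S \<inter> F i))"
    by (rule ennreal_SUP_add_right) simp
  also have "\<dots> \<le> ennreal (2 powr N * h powr (N - 1)) * emeasure M (ball x r)"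
  proof (rule SUP_least)
    fix i
    have "emeasure M (S \<inter> F i) \<le> emeasure M (F i)" by (intro emeasure_mono Fm) auto
    also have "\<dots> < \<infinity>" using F(3)[of i] by (simp add: top.not_eq_extremum)
    finally have "emeasure M (S \<inter> F i) < \<infinity>" .
    then show "emeasure M A + emeasure M (S \<inter> F i) \<le> ennreal (2 powr N * h powr (N - 1)) * emeasure M (ball x r)"
      using Fm SM by (intro main) auto
  qed
  finally show ?thesis by (simp add: h_def)
qed

text \<open>
The margin \<open>\<epsilon>\<close> of the previous lemma tends to \<open>0\<close>.
\<close>

lemma doubling_of_curvature_lower_bound:
  fixes M :: "'a::polish_space measure"
  assumes M: "metric_measure_space M" and supp: "measure_support M = UNIV"
    and N: "1 \<le> N" and CD: "CD M k N" and X': "bounded X'"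
    and K: "K \<le> 0" "\<And>z. z \<in> X' \<Longrightarrow> K \<le> k z"
  shows "doubling_on M X' (2 powr N * cosh (sqrt (- (K / (N - 1))) * diameter X') powr (N - 1))"
  unfolding doubling_on_def
proof (intro ballI allI impI)
  fix x r assume x: "x \<in> X'" and r: "0 < r" and sub: "ball x (2 * r) \<subseteq> X'"
  define C where "C = 2 powr N * cosh (sqrt (- (K / (N - 1))) * diameter X') powr (N - 1)"
  have "0 < cosh (sqrt (- (K / (N - 1))) * diameter X')" by (rule cosh_real_pos)
  then have C: "C > 0" unfolding C_def by (intro mult_pos_pos powr_gt_zero[THEN iffD2]) auto
  show "emeasure M (ball x (2 * r)) \<le> ennreal (2 powr N * cosh (sqrt (- (K / (N - 1))) * diameter X') powr (N - 1)) * emeasure M (ball x r)"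
    unfolding C_def[symmetric]
  proof (cases "emeasure M (ball x r) = \<infinity>")
    case True
    then show "emeasure M (ball x (2 * r)) \<le> ennreal C * emeasure M (ball x r)" using C by (simp add: ennreal_mult_top)
  next
    case False
    (* The summand 5 makes the margin 4 * (r / (5 + n)) smaller than r for every n. *)
    define B where "B n = ball x (2 * r - 4 * (r / (5 + real n)))" for n :: nat
    have inc: "incseq B"
      unfolding B_def incseq_def using r by (auto intro!: subset_ball divide_left_mono)
    have "(\<Union>n. B n) = ball x (2 * r)"
    proof
      show "(\<Union>n. B n) \<subseteq> ball x (2 * r)"
      proof
        fix y assume "y \<in> (\<Union>n. B n)"
        then obtain n where "dist x y < 2 * r - 4 * (r / (5 + real n))" by (auto simp: B_def)
        moreover have "0 < r / (5 + real n)" using r by simp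
        ultimately show "y \<in> ball x (2 * r)" by simp
      qed
      show "ball x (2 * r) \<subseteq> (\<Union>n. B n)"
      proof
        fix y assume y: "y \<in> ball x (2 * r)"
        define d where "d = 2 * r - dist x y"
        have d: "d > 0" using y by (simp add: d_def)
        obtain n :: nat where n: "4 * r / d < real n" using reals_Archimedean2 by blast
        have "4 * r < d * (5 + real n)" using n d by (simp add: field_simps)
        then have "4 * (r / (5 + real n)) < d" by (simp add: field_simps add_pos_nonneg)
        then have "y \<in> B n" by (simp add: B_def d_def)
        then show "y \<in> (\<Union>n. B n)" by blast
      qed
    qed
    then have "emeasure M (ball x (2 * r)) = (SUP n. emeasure M (B n))"
      using inc metric_measure_space_sets[OF M] by (subst SUP_emeasure_incseq) (auto simp: B_def)
    also have "\<dots> \<le> ennreal C * emeasure M (ball x r)"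
      unfolding C_def B_def
    proof (intro SUP_least doubling_smaller_balls[OF M supp N CD X' sub K])
      show "emeasure M (ball x r) < \<infinity>" using False by (simp add: top.not_eq_extremum)
      show "0 < r / (5 + real n)" "4 * (r / (5 + real n)) < r" for n
        using r by (auto simp: field_simps add_pos_nonneg)
    qed (use r in auto)
    finally show "emeasure M (ball x (2 * r)) \<le> ennreal C * emeasure M (ball x r)" .
  qed
qed

section \<open>Properness and lower bounds on bounded sets\<close>

text \<open>
Transporting mass from a small ball around \<open>x\<close> to one around \<open>y\<close> produces a geodesic with end points close to \<open>x\<close> and \<open>y\<close>;
its point at time \<open>s / dist x y\<close> is an approximate intermediate point.
\<close>

lemma CD_length_space:
  fixes M :: "'a::polish_space measure" and x y :: 'a
  assumes M: "metric_measure_space M" and supp: "measure_support M = UNIV" and CD: "CD M k N"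
    and s: "0 \<le> s" "s \<le> dist x y" "0 < e"
  shows "\<exists>z. dist x z < s + e \<and> dist z y < dist x y - s + e"
proof (cases "x = y")
  case True
  then show ?thesis using s by (intro exI[of _ x]) auto
next
  case False
  have pos: "0 < emeasure M (ball y e)" if "e > 0" for y :: 'a and e
    using supp that by (auto simp: measure_support_def)
  have small: "\<exists>r>0. r < e / 4 \<and> emeasure M (ball x r) < \<infinity>" for x :: 'a
  proof -
    obtain r where r: "r > 0" "emeasure M (ball x r) < \<infinity>"
      using M unfolding metric_measure_space_def by metis
    have "emeasure M (ball x (min r (e/8))) \<le> emeasure M (ball x r)"
      using metric_measure_space_sets[OF M] by (intro emeasure_mono) auto
    also note r(2)
    finally show ?thesis using r(1) s by (intro exI[of _ "min r (e/8)"]) auto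
  qed
  obtain a where a: "a > 0" "a < e / 4" "emeasure M (ball x a) < \<infinity>" using small by blast
  obtain b where b: "b > 0" "b < e / 4" "emeasure M (ball y b) < \<infinity>" using small by blast
  have borel: "ball x a \<in> sets borel" "ball y b \<in> sets borel" by auto
  note ua = uniform_density_measure[OF M borel(1) order_refl pos[OF a(1)] a(3)]
  note ub = uniform_density_measure[OF M borel(2) order_refl pos[OF b(1)] b(3)]
  obtain \<Xi> where \<Xi>: "dynamical_optimal_coupling (density M (\<lambda>z. ennreal (uniform_density M (ball x a) z)))
      (density M (\<lambda>z. ennreal (uniform_density M (ball y b) z))) \<Xi>"
    using CD[unfolded CD_def, rule_format, OF ua(1,2) ub(1,2) ua(3,4) ub(3,4)] by blast
  interpret \<Xi>: prob_space \<Xi> using \<Xi> by (simp add: dynamical_optimal_coupling_def)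
  have "\<exists>\<gamma>. \<gamma> \<in> geodesics \<and> apply_bcontfun \<gamma> 0 \<in> ball x a \<and> apply_bcontfun \<gamma> 1 \<in> ball y b"
  proof (rule ccontr)
    assume "\<not> ?thesis"
    then have "AE \<gamma> in \<Xi>. False"
      by (intro eventually_mono[OF dynamical_coupling_AE[OF \<Xi> ua(5) ub(5)]]) blast
    then show False by simp
  qed
  then obtain \<gamma> where \<gamma>: "\<gamma> \<in> geodesics" "dist x (apply_bcontfun \<gamma> 0) < a" "dist y (apply_bcontfun \<gamma> 1) < b"
    by auto
  define d where "d = dist x y"
  have d: "d > 0" using False by (simp add: d_def)
  define t where "t = s / d"
  have t: "t \<in> {0..1}" "t * d = s" using s d by (auto simp: t_def d_def)
  define \<theta> where "\<theta> = dist (apply_bcontfun \<gamma> 0) (apply_bcontfun \<gamma> 1)"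
  define z where "z = apply_bcontfun \<gamma> t"
  have "\<theta> \<le> a + d + b"
    using \<gamma>(2,3) dist_triangle[of "apply_bcontfun \<gamma> 0" "apply_bcontfun \<gamma> 1" x]
      dist_triangle[of x "apply_bcontfun \<gamma> 1" y] by (simp add: \<theta>_def d_def dist_commute)
  then have \<theta>: "\<theta> \<le> d + e / 2" using a b by simp
  have "geodesic_wrt dist (apply_bcontfun \<gamma>)" using \<gamma>(1) by (simp add: geodesics_def)
  note g = this[unfolded geodesic_wrt_def, rule_format, folded \<theta>_def]
  have g0: "dist (apply_bcontfun \<gamma> 0) z = t * \<theta>" and g1: "dist z (apply_bcontfun \<gamma> 1) = (1 - t) * \<theta>"
    using g[of 0 t] g[of t 1] t by (auto simp: z_def)
  have "t * \<theta> \<le> t * (d + e / 2)" "(1 - t) * \<theta> \<le> (1 - t) * (d + e / 2)"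
    using t \<theta> by (auto intro!: mult_left_mono)
  moreover have "t * (e / 2) \<le> e / 2" "(1 - t) * (e / 2) \<le> e / 2"
    using t s by (auto intro!: mult_left_le_one_le)
  moreover have "t * (d + e / 2) = s + t * (e / 2)" "(1 - t) * (d + e / 2) = d - s + (1 - t) * (e / 2)"
    using t by (auto simp: algebra_simps)
  ultimately have "t * \<theta> \<le> s + e / 2" "(1 - t) * \<theta> \<le> d - s + e / 2" by linarith+
  then have "dist x z < s + e" "dist z y < d - s + e"
    using \<gamma>(2,3) a b g0 g1 s dist_triangle[of x z "apply_bcontfun \<gamma> 0"]
      dist_triangle[of z y "apply_bcontfun \<gamma> 1"]
    by (simp_all add: dist_commute)
  then show ?thesis by (auto simp: d_def)
qed

text \<open>
The classical volume count. By iterated doubling all balls of radius \<open>\<rho> \<le> e / 2\<close> with centre in \<open>ball x (R / 4)\<close> have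
measure bounded away from \<open>0\<close>. Around an \<open>e\<close>-separated set such balls are disjoint parts of a ball of finite measure, so the
cardinality of separated sets is bounded, and one of maximal cardinality is an \<open>e\<close>-net.
\<close>

lemma doubling_imp_totally_bounded:
  fixes M :: "'a::polish_space measure"
  assumes M: "metric_measure_space M" and supp: "measure_support M = UNIV"
    and D: "doubling_on M (ball x R) C" and fin: "emeasure M (ball x R) < \<infinity>" and R: "R > 0" and e: "e > 0"
  shows "\<exists>F. finite F \<and> ball x (R / 4) \<subseteq> (\<Union>y\<in>F. ball y e)"
proof -
  note s = metric_measure_space_sets[OF M]
  have pos: "0 < emeasure M (ball y e)" if "e > 0" for y :: 'a and e
    using supp that by (auto simp: measure_support_def)
  have doub: "emeasure M (ball y (R / 2)) \<le> ennreal C ^ n * emeasure M (ball y (R / 2 / 2 ^ n))"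
    if y: "y \<in> ball x (R / 4)" for y n
  proof (induction n)
    case (Suc n)
    have "ball y (2 * (R / 2 / 2 ^ Suc n)) \<subseteq> ball x R"
    proof
      fix z assume "z \<in> ball y (2 * (R / 2 / 2 ^ Suc n))"
      then have "dist y z < R / 2 / 2 ^ n" by simp
      also have "\<dots> \<le> R / 2" using R by (simp add: field_simps)
      finally show "z \<in> ball x R" using y R dist_triangle[of x z y] by auto
    qed
    moreover have "y \<in> ball x R" using y R by auto
    ultimately have "emeasure M (ball y (2 * (R / 2 / 2 ^ Suc n))) \<le> ennreal C * emeasure M (ball y (R / 2 / 2 ^ Suc n))"
      using D R unfolding doubling_on_def by (metis divide_pos_pos zero_less_numeral zero_less_power)
    then have "emeasure M (ball y (R / 2 / 2 ^ n)) \<le> ennreal C * emeasure M (ball y (R / 2 / 2 ^ Suc n))"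
      by simp
    then have "ennreal C ^ n * emeasure M (ball y (R / 2 / 2 ^ n))
        \<le> ennreal C ^ n * (ennreal C * emeasure M (ball y (R / 2 / 2 ^ Suc n)))"
      by (rule mult_left_mono) simp
    with Suc show ?case by (simp add: mult_ac)
  qed simp
  obtain n where n: "R / e < 2 ^ n" using real_arch_pow[of 2 "R / e"] by auto
  define \<rho> where "\<rho> = R / 2 / 2 ^ n"
  have \<rho>: "0 < \<rho>" "\<rho> \<le> e / 2" using n R e by (auto simp: \<rho>_def field_simps)
  have \<rho>R: "\<rho> \<le> R / 2" using R by (simp add: \<rho>_def field_simps)
  define v where "v = emeasure M (ball x (R / 4))"
  define T where "T = ennreal C ^ n * emeasure M (ball x R)"
  have v: "v > 0" using pos R by (simp add: v_def)
  have "v \<le> emeasure M (ball x R)"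
    unfolding v_def using R s by (intro emeasure_mono) auto
  then have vfin: "v < \<infinity>" using fin by (rule order.strict_trans1)
  have T: "T < \<infinity>" using fin by (simp add: T_def ennreal_mult_less_top power_less_top_ennreal)
  have vle: "v \<le> ennreal C ^ n * emeasure M (ball y \<rho>)" if y: "y \<in> ball x (R / 4)" for y
  proof -
    have "ball x (R / 4) \<subseteq> ball y (R / 2)"
    proof
      fix z assume "z \<in> ball x (R / 4)"
      then show "z \<in> ball y (R / 2)"
        using y dist_triangle[of y z x] by (simp add: dist_commute)
    qed
    then have "v \<le> emeasure M (ball y (R / 2))"
      unfolding v_def using s by (intro emeasure_mono) auto
    also note doub[OF y, of n]
    finally show ?thesis by (simp add: \<rho>_def)
  qed
  define sep where "sep F \<longleftrightarrow> finite F \<and> F \<subseteq> ball x (R / 4) \<and> (\<forall>y\<in>F. \<forall>z\<in>F. y \<noteq> z \<longrightarrow> e \<le> dist y z)" for F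
  have card: "of_nat (card F) * v \<le> T" if F: "sep F" for F
  proof -
    have F': "finite F" "F \<subseteq> ball x (R / 4)" "\<And>y z. y \<in> F \<Longrightarrow> z \<in> F \<Longrightarrow> y \<noteq> z \<Longrightarrow> e \<le> dist y z"
      using F by (auto simp: sep_def)
    have "of_nat (card F) * v = (\<Sum>y\<in>F. v)" by simp
    also have "\<dots> \<le> (\<Sum>y\<in>F. ennreal C ^ n * emeasure M (ball y \<rho>))"
      using F' vle by (intro sum_mono) auto
    also have "\<dots> = ennreal C ^ n * (\<Sum>y\<in>F. emeasure M (ball y \<rho>))"
      by (simp add: sum_distrib_left)
    also have "(\<Sum>y\<in>F. emeasure M (ball y \<rho>)) = emeasure M (\<Union>y\<in>F. ball y \<rho>)"
    proof (rule sum_emeasure)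
      show "disjoint_family_on (\<lambda>y. ball y \<rho>) F"
      proof (unfold disjoint_family_on_def, intro ballI impI)
        fix y z assume yz: "y \<in> F" "z \<in> F" "y \<noteq> z"
        show "ball y \<rho> \<inter> ball z \<rho> = {}"
        proof (rule ccontr)
          assume "ball y \<rho> \<inter> ball z \<rho> \<noteq> {}"
          then obtain w where "dist y w < \<rho>" "dist z w < \<rho>" by auto
          then show False using F'(3)[OF yz] \<rho> dist_triangle2[of y z w] by simp
        qed
      qed
    qed (use F' s in auto)
    also have "emeasure M (\<Union>y\<in>F. ball y \<rho>) \<le> emeasure M (ball x R)"
    proof (rule emeasure_mono)
      show "(\<Union>y\<in>F. ball y \<rho>) \<subseteq> ball x R"
      proof
        fix z assume "z \<in> (\<Union>y\<in>F. ball y \<rho>)"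
        then obtain y where "y \<in> F" "dist y z < \<rho>" by auto
        moreover from this F'(2) have "dist x y < R / 4" by auto
        ultimately show "z \<in> ball x R" using \<rho>R R dist_triangle[of x z y] by simp
      qed
    qed (use s in auto)
    finally show ?thesis by (simp add: T_def mult_left_mono)
  qed
  obtain B :: nat where B: "enn2real T / enn2real v < real B" using reals_Archimedean2 by blast
  have bound: "card F < Suc B" if F: "sep F" for F
  proof -
    have "real (card F) * enn2real v = enn2real (of_nat (card F) * v)"
      by (simp add: enn2real_mult)
    also have "\<dots> \<le> enn2real T"
      using card[OF F] T by (intro enn2real_mono) auto
    also have "enn2real v > 0"
      using v vfin by (simp add: enn2real_positive_iff)
    then have "enn2real T < real B * enn2real v"
      using B by (simp add: field_simps)
    finally have "real (card F) < real B"
      using \<open>enn2real v > 0\<close> by simp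
    then show ?thesis by simp
  qed
  have "sep {}" by (simp add: sep_def)
  then obtain F where F: "sep F" "\<And>G. sep G \<Longrightarrow> card G \<le> card F"
    using ex_has_greatest_nat[of sep "{}" card "Suc B"] bound by blast
  have "ball x (R / 4) \<subseteq> (\<Union>y\<in>F. ball y e)"
  proof (rule ccontr)
    assume "\<not> ?thesis"
    then obtain z where z: "z \<in> ball x (R / 4)" "z \<notin> (\<Union>y\<in>F. ball y e)" by blast
    then have far: "\<And>y. y \<in> F \<Longrightarrow> e \<le> dist y z" by (auto simp: not_less)
    have "sep (insert z F)"
      using F(1) z(1) far by (auto simp: sep_def dist_commute)
    moreover have "z \<notin> F" using far[of z] e by auto
    ultimately show False using F(2)[of "insert z F"] F(1) by (simp add: sep_def)
  qed
  then show ?thesis using F(1) by (auto simp: sep_def)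
qed

lemma totally_bounded_imp_compact:
  fixes S :: "'a::complete_space set"
  assumes "closed S" and "\<And>e. e > 0 \<Longrightarrow> \<exists>F. finite F \<and> S \<subseteq> (\<Union>y\<in>F. ball y e)"
  shows "compact S"
  using assms by (simp add: compact_eq_totally_bounded complete_eq_closed)

text \<open>
The theorem of Hopf and Rinow, in a form that uses only approximate intermediate points. Let \<open>\<sigma>\<close> be the supremum of the radii
of compact balls around \<open>x\<close>. The ball of radius \<open>\<sigma>\<close> is totally bounded because slightly smaller
compact balls nearly exhaust it; and finitely many compact balls cover a neighbourhood of it, so a slightly larger ball is compact as
well.
\<close>

lemma locally_compact_length_space_proper:
  fixes x :: "'a::complete_space"
  assumes len: "\<And>(x::'a) y s e. 0 \<le> s \<Longrightarrow> s \<le> dist x y \<Longrightarrow> 0 < e \<Longrightarrow>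
      \<exists>z. dist x z < s + e \<and> dist z y < dist x y - s + e"
    and loc: "\<And>x::'a. \<exists>r>0. compact (cball x r)"
  shows "compact (cball x R)"
proof (rule ccontr)
  assume R: "\<not> compact (cball x R)"
  have near: "\<exists>z\<in>cball x t. dist z y < 3 * a" if a: "0 \<le> t" "0 < a" "dist x y \<le> t + a" for t a y
  proof (cases "dist x y \<le> t")
    case True
    then show ?thesis using a by (intro bexI[of _ y]) auto
  next
    case False
    show ?thesis
    proof (cases "a \<le> t")
      case True
      obtain z where "dist x z < t - a + a" "dist z y < dist x y - (t - a) + a"
        using len[of "t - a" x y a] True False a by auto
      then show ?thesis using a by (intro bexI[of _ z]) auto
    next
      case False
      then show ?thesis using a by (intro bexI[of _ x]) auto
    qed
  qed
  define S where "S = {t. 0 \<le> t \<and> compact (cball x t)}"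
  have smaller: "compact (cball x t)" if "compact (cball x t')" "t \<le> t'" for t t'
  proof -
    have "cball x t' \<inter> cball x t = cball x t" using that(2) by auto
    then show ?thesis using compact_Int_closed[OF that(1) closed_cball[of x t]] by simp
  qed
  have SR: "t < R" if "t \<in> S" for t
    using smaller[of t R] R that by (force simp: S_def)
  then have bdd: "bdd_above S" by (intro bdd_aboveI[of _ R]) (auto intro: less_imp_le)
  obtain r where "r > 0" "compact (cball x r)" using loc by blast
  then have S: "S \<noteq> {}" by (auto simp: S_def intro: less_imp_le)
  define \<sigma> where "\<sigma> = Sup S"
  have \<sigma>0: "0 \<le> \<sigma>" using S bdd by (metis S_def \<sigma>_def cSup_upper2 ex_in_conv mem_Collect_eq)
  have "compact (cball x \<sigma>)"
  proof (rule totally_bounded_imp_compact)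
    fix e :: real assume e: "e > 0"
    obtain t where t: "t \<in> S" "\<sigma> - e / 6 < t"
      using less_cSup_iff[OF S bdd, of "\<sigma> - e / 6"] e by (auto simp: \<sigma>_def)
    then have "compact (cball x t)" by (simp add: S_def)
    then obtain F where F: "finite F" "cball x t \<subseteq> (\<Union>y\<in>F. ball y (e / 2))"
      using e unfolding compact_eq_totally_bounded by (meson half_gt_zero)
    have "cball x \<sigma> \<subseteq> (\<Union>y\<in>F. ball y e)"
    proof
      fix y assume "y \<in> cball x \<sigma>"
      then obtain z where z: "z \<in> cball x t" "dist z y < 3 * (e / 6)"
        using near[of t "e / 6" y] t e by (auto simp: S_def)
      then obtain c where "c \<in> F" "dist c z < e / 2" using F by auto
      then show "y \<in> (\<Union>y\<in>F. ball y e)"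
        using z(2) dist_triangle[of c y z] by (intro UN_I[of c]) auto
    qed
    then show "\<exists>F. finite F \<and> cball x \<sigma> \<subseteq> (\<Union>y\<in>F. ball y e)" using F(1) by blast
  qed simp
  moreover obtain r where r: "\<And>p. 0 < r p" "\<And>p::'a. compact (cball p (r p))" using loc by metis
  have "p \<in> ball p (r p / 2)" for p using r(1)[of p] by simp
  then have "cball x \<sigma> \<subseteq> (\<Union>p\<in>UNIV. ball p (r p / 2))" by blast
  ultimately obtain F where F: "finite F" "cball x \<sigma> \<subseteq> (\<Union>p\<in>F. ball p (r p / 2))"
    using compactE_image[of "cball x \<sigma>" UNIV "\<lambda>p. ball p (r p / 2)"] by (metis open_ball)
  have Fne: "F \<noteq> {}" using F(2) \<sigma>0 by auto
  define \<delta> where "\<delta> = Min ((\<lambda>p. r p / 2) ` F)"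
  have \<delta>: "\<delta> > 0" "\<And>p. p \<in> F \<Longrightarrow> \<delta> \<le> r p / 2"
    unfolding \<delta>_def using F(1) Fne r(1) by (auto intro: Min_le simp del: le_divide_eq_numeral1)
  have sub: "cball x (\<sigma> + \<delta> / 3) \<subseteq> (\<Union>p\<in>F. cball p (r p))"
  proof
    fix y assume "y \<in> cball x (\<sigma> + \<delta> / 3)"
    then obtain z where z: "z \<in> cball x \<sigma>" "dist z y < 3 * (\<delta> / 3)"
      using near[of \<sigma> "\<delta> / 3" y] \<sigma>0 \<delta>(1) by auto
    then obtain p where p: "p \<in> F" "dist p z < r p / 2" using F(2) by auto
    then show "y \<in> (\<Union>p\<in>F. cball p (r p))"
      using z(2) \<delta>(2)[of p] dist_triangle[of p y z] by (intro UN_I[of p]) auto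
  qed
  have "compact (\<Union>p\<in>F. cball p (r p))"
    using F(1) r(2) by (intro compact_UN) auto
  from compact_Int_closed[OF this closed_cball[of x "\<sigma> + \<delta> / 3"]]
  have "compact (cball x (\<sigma> + \<delta> / 3))"
    using sub by (simp add: Int_absorb1)
  then have "\<sigma> + \<delta> / 3 \<in> S" using \<sigma>0 \<delta>(1) by (simp add: S_def)
  then have "\<sigma> + \<delta> / 3 \<le> \<sigma>" unfolding \<sigma>_def using bdd by (rule cSup_upper)
  then show False using \<delta>(1) by simp
qed

lemma locally_bdd_below_compact:
  fixes k :: "'a::metric_space \<Rightarrow> real"
  assumes loc: "\<And>x. \<exists>r>0. bdd_below (k ` ball x r)" and S: "compact S"
  shows "bdd_below (k ` S)"
proof -
  obtain r where r: "\<And>p. 0 < r p" "\<And>p. bdd_below (k ` ball p (r p))" using loc by metis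
  have "S \<subseteq> (\<Union>p\<in>UNIV. ball p (r p))" using r(1) centre_in_ball by blast
  then obtain F where F: "finite F" "S \<subseteq> (\<Union>p\<in>F. ball p (r p))"
    using compactE_image[OF S, of UNIV "\<lambda>p. ball p (r p)"] by (metis open_ball)
  have "bdd_below (\<Union>p\<in>F. k ` ball p (r p))"
    using F(1) r(2) by (simp add: bdd_below_UN)
  then have "bdd_below (k ` (\<Union>p\<in>F. ball p (r p)))" by (simp only: image_UN)
  then show ?thesis using F(2) by (rule bdd_below_mono[OF _ image_mono])
qed

text \<open>
An admissible function is bounded below only near each point, and bounded sets are not known to be relatively compact
at first. But near each point the curvature bound gives doubling, hence compact small balls; then Hopf-Rinow makes all closed balls compact.
\<close>

lemma CD_bounded_below:
  fixes M :: "'a::polish_space measure"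
  assumes M: "metric_measure_space M" and supp: "measure_support M = UNIV"
    and k: "admissible k" and N: "1 \<le> N" and CD: "CD M k N" and X': "bounded X'"
  shows "bdd_below (k ` X')"
proof -
  have loc: "\<exists>r>0. bdd_below (k ` ball x r)" for x :: 'a
    using k unfolding admissible_def by blast
  have "\<exists>r>0. compact (cball x r)" for x :: 'a
  proof -
    obtain r1 where r1: "r1 > 0" "bdd_below (k ` ball x r1)" using loc[of x] by blast
    have "\<exists>r>0. 0 < emeasure M (ball x r) \<and> emeasure M (ball x r) < \<infinity>"
      using M unfolding metric_measure_space_def by blast
    then obtain r2 where r2: "r2 > 0" "emeasure M (ball x r2) < \<infinity>" by blast
    define R where "R = min r1 r2"
    have R: "R > 0" using r1 r2 by (simp add: R_def)
    obtain b where b: "\<And>z. z \<in> ball x R \<Longrightarrow> b \<le> k z"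
    proof -
      obtain b where b: "\<And>z. z \<in> ball x r1 \<Longrightarrow> b \<le> k z"
        using r1(2) unfolding bdd_below_def by blast
      show ?thesis by (rule that[of b]) (use b in \<open>simp add: R_def\<close>)
    qed
    have fin: "emeasure M (ball x R) < \<infinity>"
      using metric_measure_space_sets[OF M] by (intro order.strict_trans1[OF emeasure_mono r2(2)]) (auto simp: R_def)
    have "doubling_on M (ball x R) (2 powr N * cosh (sqrt (- (min 0 b / (N - 1))) * diameter (ball x R)) powr (N - 1))"
      by (rule doubling_of_curvature_lower_bound[OF M supp N CD]) (auto simp: min_le_iff_disj b)
    note tb = doubling_imp_totally_bounded[OF M supp this fin R]
    have "compact (cball x (R / 8))"
    proof (rule totally_bounded_imp_compact)
      fix e :: real assume "e > 0"
      from tb[OF this] show "\<exists>F. finite F \<and> cball x (R / 8) \<subseteq> (\<Union>y\<in>F. ball y e)"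
        using R by (force simp: subset_eq)
    qed simp
    then show ?thesis using R by (intro exI[of _ "R / 8"]) simp
  qed
  from locally_compact_length_space_proper[OF CD_length_space[OF M supp CD] this]
  have proper: "compact (cball x R)" for x :: 'a and R .
  obtain x R where "X' \<subseteq> cball x R" using X' by (auto simp: bounded_def subset_eq)
  moreover have "bdd_below (k ` cball x R)" by (rule locally_bdd_below_compact[OF loc proper])
  ultimately show ?thesis by (meson bdd_below_mono image_mono)
qed

theorem corollary5p4:
  fixes M :: "'a::polish_space measure" and k :: "'a \<Rightarrow> real" and N :: real and X' :: "'a set"
  assumes "metric_measure_space M" and "measure_support M = UNIV"
    and "admissible k" and "N \<ge> 1" and "CD M k N" and "bounded X'"
  shows "(\<exists>C. doubling_on M X' C) \<and>
    ((\<forall>x\<in>X'. k x \<ge> 0) \<longrightarrow> doubling_on M X' (2 powr N)) \<and>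
    (\<not> (\<forall>x\<in>X'. k x \<ge> 0) \<longrightarrow>
       bdd_below (k ` X') \<and>
       doubling_on M X' (2 powr N *
         (if N = 1 then 1
          else cn ((INF x\<in>X'. k x) / (N - 1)) (diameter X') powr (N - 1))))"
proof -
  note doubling = doubling_of_curvature_lower_bound[OF assms(1,2,4,5,6)]
  have bdd: "bdd_below (k ` X')" by (rule CD_bounded_below[OF assms])
  have nonneg: "doubling_on M X' (2 powr N)" if "\<forall>x\<in>X'. k x \<ge> 0"
    using doubling[of 0] that by simp
  have neg: "doubling_on M X' (2 powr N *
         (if N = 1 then 1
          else cn ((INF x\<in>X'. k x) / (N - 1)) (diameter X') powr (N - 1)))"
    if not_nonneg: "\<not> (\<forall>x\<in>X'. k x \<ge> 0)"
  proof -
    define K where "K = (INF x\<in>X'. k x)"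
    have K: "K \<le> k x" if "x \<in> X'" for x unfolding K_def by (rule cINF_lower[OF bdd that])
    have K0: "K \<le> 0" using not_nonneg K by force
    have "K / (N - 1) \<le> 0" using K0 assms(4) by (simp add: divide_nonpos_nonneg)
    then show ?thesis
      using doubling[OF K0 K] unfolding K_def[symmetric] by (cases "N = 1") (auto simp: cn_eq_cosh)
  qed
  show ?thesis using bdd nonneg neg by blast
qed

end
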